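(* Let $d\ge 2$ and let $\mu$ be a finite measure on $]0,+\infty[$ with positive mass. Let $s>0$, $\lambda>0$ and $\rho>1$. Let $D^{\rho}(\lambda\mu)$ denote the Euclidean diameter of the connected component of $\Sigma^{\rho}(\lambda\mu)$ that contains the origin. 1. If $\int_{[1,+\infty[}\beta^{d+s}\,\mu(d\beta)<\infty$ and $P\left(S(r/2)\leftrightarrow_{\Sigma^{\rho}(\lambda\mu)}S(r)\right)\to0$ as $r\to\infty$, then $E\big((D^{\rho}(\lambda\mu))^s\big)<\infty$. 2. If $\int_{[1,+\infty[}\beta^{d+s}\,\mu(d\beta)=\infty$, then $E\big((D^{\rho}(\lambda\mu))^s\big)=\infty$.
   Context: Boolean model: for a finite measure $\nu$ on $]0,+\infty[$, let $\xi$ be a Poisson point process on $\mathbb{R}^d\times]0,+\infty[$ with intensity the product of Lebesgue measure on $\mathbb{R}^d$ by $\nu$; the Boolean model driven by $\nu$ is the random set $\Sigma(\nu)=\bigcup_{(c,r)\in\xi}B(c,r)$, where $B(c,r)$ is the open Euclidean ball of radius $r$ centered at $c$. Multiscale Boolean model: for $\rho>1$, let $(\Sigma_n)_{n\ge0}$ be independent copies of $\Sigma(\nu)$ and set $\Sigma^{\rho}(\nu)=\bigcup_{n\ge 0}\rho^{-n}\Sigma_n$. $S(r)=\{x\in\mathbb{R}^d:\|x\|_2=r\}$. For $A,B\subset\mathbb{R}^d$ and a random set $\Sigma$, $A\leftrightarrow_{\Sigma}B$ denotes the event that there exists a continuous path contained in $\Sigma$ from a point of $A$ to a point of $B$. The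 component containing the origin is empty (diameter $0$) if the origin is not in the set; the diameter may be $+\infty$. *)

theory Defs
  imports "HOL-Probability.Probability"
begin

section \<open>Poisson point processes\<close>

text \<open>
  A configuration is a set of points. Multiplicities are not recorded; this is harmless for a
  Poisson process whose intensity has no atoms, since such a process is almost surely simple.
\<close>

definition num_points :: "'a set \<Rightarrow> 'a set \<Rightarrow> ennreal" where
  "num_points A \<eta> = emeasure (count_space UNIV) (\<eta> \<inter> A)"

definition configurations :: "'a measure \<Rightarrow> 'a set measure" where
  "configurations \<Lambda> = sigma (Pow (space \<Lambda>))
     {num_points A -` B \<inter> Pow (space \<Lambda>) | A B. A \<in> sets \<Lambda> \<and> B \<in> sets borel}"

text \<open>
  If the intensity of \<open>A\<close> is \<open>0\<close>, the convention \<open>0 ^ 0 = 1\<close> makes the Poisson law below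
  the Dirac mass at \<open>0\<close>. In the last clause the sets themselves serve as indices.
\<close>

definition (in prob_space) poisson_point_process :: "'b measure \<Rightarrow> ('a \<Rightarrow> 'b set) \<Rightarrow> bool" where
  "poisson_point_process \<Lambda> \<xi> \<longleftrightarrow>
     random_variable (configurations \<Lambda>) \<xi> \<and>
     (\<forall>A\<in>sets \<Lambda>. emeasure \<Lambda> A < \<infinity> \<longrightarrow>
        (\<forall>k::nat. prob {\<omega> \<in> space M. num_points A (\<xi> \<omega>) = of_nat k} =
           exp (- measure \<Lambda> A) * measure \<Lambda> A ^ k / fact k)) \<and>
     (\<forall>A\<in>sets \<Lambda>. emeasure \<Lambda> A = \<infinity> \<longrightarrow> (AE \<omega> in M. num_points A (\<xi> \<omega>) = \<infinity>)) \<and>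
     (\<forall>\<A>. finite \<A> \<and> \<A> \<subseteq> sets \<Lambda> \<and> disjoint \<A> \<longrightarrow>
        indep_vars (\<lambda>_. borel) (\<lambda>A \<omega>. num_points A (\<xi> \<omega>)) \<A>)"


section \<open>Boolean models\<close>

text \<open>
  A measure on the open half-line is a measure \<open>\<nu>\<close> on the type \<open>real\<close> whose sigma-algebra is
  that of \<open>restrict_space borel {0<..}\<close>, so that \<open>space \<nu> = {0<..}\<close>.
\<close>

definition boolean_intensity :: "real measure \<Rightarrow> ((real ^ 'd) \<times> real) measure" where
  "boolean_intensity \<nu> = lborel \<Otimes>\<^sub>M \<nu>"

definition boolean_set :: "((real ^ 'd) \<times> real) set \<Rightarrow> (real ^ 'd) set" where
  "boolean_set \<eta> = (\<Union>(c, r)\<in>\<eta>. ball c r)"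

definition multiscale_set :: "real \<Rightarrow> (nat \<Rightarrow> ((real ^ 'd) \<times> real) set) \<Rightarrow> (real ^ 'd) set" where
  "multiscale_set \<rho> \<eta> = (\<Union>n. (\<lambda>x. (1 / \<rho> ^ n) *\<^sub>R x) ` boolean_set (\<eta> n))"

text \<open>
  The processes \<open>\<xi> n\<close> drive independent copies of the Boolean model with radius measure \<open>\<nu>\<close>.
\<close>

definition (in prob_space) independent_boolean_drivers ::
    "real measure \<Rightarrow> (nat \<Rightarrow> 'a \<Rightarrow> ((real ^ 'd) \<times> real) set) \<Rightarrow> bool" where
  "independent_boolean_drivers \<nu> \<xi> \<longleftrightarrow>
     (\<forall>n. poisson_point_process (boolean_intensity \<nu>) (\<xi> n)) \<and>
     indep_vars (\<lambda>_. configurations (boolean_intensity \<nu>)) \<xi> UNIV"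


section \<open>Crossings and diameters\<close>

definition joined_in :: "'a::topological_space set \<Rightarrow> 'a set \<Rightarrow> 'a set \<Rightarrow> bool" where
  "joined_in S A B \<longleftrightarrow>
     (\<exists>g. path g \<and> path_image g \<subseteq> S \<and> pathstart g \<in> A \<and> pathfinish g \<in> B)"

text \<open>
  The library's \<open>diameter\<close> is real-valued and is \<open>0\<close> for unbounded sets; here unbounded sets
  have diameter \<open>\<infinity>\<close>. The supremum over the empty set is \<open>0\<close>.
\<close>

definition ediameter :: "'a::metric_space set \<Rightarrow> ennreal" where
  "ediameter S = (SUP x\<in>S. SUP y\<in>S. ennreal (dist x y))"

text \<open>Intended for exponents \<open>s > 0\<close>.\<close>

definition epowr :: "ennreal \<Rightarrow> real \<Rightarrow> ennreal" where
  "epowr x s = (if x = \<infinity> then \<infinity> else ennreal (enn2real x powr s))"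

definition origin_diameter :: "(real ^ 'd) set \<Rightarrow> ennreal" where
  "origin_diameter S = ediameter (connected_component_set S 0)"

end

theory Submission
  imports Defs
begin

text \<open>
  Superposing the rescaled Poisson processes gives one process of balls whose void probabilities are
  \<open>exp (- \<Lambda> A)\<close>, with \<open>\<Lambda>\<close> invariant under translation of the centres. Void events are closed
  under intersection and determine the random set, so they alone yield stationarity and the
  independence of events that depend on disjoint regions.

  Let \<open>p a\<close> be the probability that \<open>S(a)\<close> is joined to \<open>S(8a)\<close> by balls centred in \<open>B(0, 10a)\<close>.
  If no ball of radius at least \<open>a\<close> is centred in \<open>B(0, 100a)\<close>, a crossing at scale \<open>10a\<close> forces
  two crossings at scale \<open>a\<close>, one around a point of a finite net of \<open>S(10a)\<close> and one around a point
  of a finite net of \<open>S(80a)\<close>, and these are independent. Hence \<open>p (10a) \<le> C (p a)\<^sup>2 + g a\<close>, where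
  \<open>g a\<close> is the intensity of the large balls. The moment condition makes \<open>10\<^sup>k\<^sup>s g (10\<^sup>k)\<close> summable,
  and as \<open>p\<close> tends to \<open>0\<close> the same follows for \<open>10\<^sup>k\<^sup>s p (10\<^sup>k)\<close>, which controls the moment of the
  diameter. Conversely, a ball of radius \<open>r\<close> covering the origin makes the diameter at least \<open>r\<close>,
  and without the moment condition such balls already give an infinite moment.
\<close>

section \<open>Void probabilities\<close>

text \<open>Infinity is treated apart because \<open>enn2real\<close> sends it to 0, which would
  give the value 1. The value 0 is the limit of exp(-x), and the void probability of a region that
  almost surely holds infinitely many points.\<close>

definition neg_exp :: "ennreal \<Rightarrow> real" where
  "neg_exp x = (if x = \<infinity> then 0 else exp (- enn2real x))"

lemma neg_exp_nonneg: "0 \<le> neg_exp x"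
  by (simp add: neg_exp_def)

lemma neg_exp_ennreal: "0 \<le> x \<Longrightarrow> neg_exp (ennreal x) = exp (- x)"
  by (simp add: neg_exp_def)

lemma neg_exp_top [simp]: "neg_exp \<top> = 0"
  by (simp add: neg_exp_def)

lemma neg_exp_0 [simp]: "neg_exp 0 = 1"
  by (simp add: neg_exp_def)

lemma neg_exp_add: "neg_exp (x + y) = neg_exp x * neg_exp y"
  by (cases x; cases y) (auto simp: neg_exp_ennreal mult_exp_exp simp flip: ennreal_plus)

lemma neg_exp_antimono: "x \<le> y \<Longrightarrow> neg_exp y \<le> neg_exp x"
  by (cases x; cases y) (auto simp: neg_exp_ennreal neg_exp_nonneg top_unique)

lemma one_minus_neg_exp_le: "ennreal (1 - neg_exp x) \<le> x"
proof (cases x)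
  case (real r)
  have "1 - exp (- r) \<le> r" using exp_ge_add_one_self[of "- r"] by simp
  then show ?thesis using real by (simp add: neg_exp_ennreal ennreal_leI)
qed simp

lemma prod_neg_exp: "finite I \<Longrightarrow> (\<Prod>i\<in>I. neg_exp (f i)) = neg_exp (\<Sum>i\<in>I. f i)"
  by (induction I rule: finite_induct) (auto simp: neg_exp_add)

text \<open>Used for the superposition of countably many independent levels: void probabilities
  multiply while intensities add. A divergent sum needs its own argument, since
  \<open>enn2real\<close> is not continuous at infinity.\<close>

lemma prod_neg_exp_tendsto: "(\<lambda>N. \<Prod>n<N. neg_exp (f n)) \<longlonglongrightarrow> neg_exp (\<Sum>n. f n)"
proof -
  have lim: "(\<lambda>N. \<Sum>n<N. f n) \<longlonglongrightarrow> (\<Sum>n. f n)" by (intro summable_LIMSEQ) simp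
  have "(\<lambda>N. neg_exp (\<Sum>n<N. f n)) \<longlonglongrightarrow> neg_exp (\<Sum>n. f n)"
  proof (cases "(\<Sum>n. f n) = \<infinity>")
    case True
    have "\<forall>\<^sub>F N in sequentially. norm (neg_exp (\<Sum>n<N. f n)) < e" if "e > 0" for e
    proof -
      define K where "K = max 0 (1 - ln e)"
      have "\<forall>\<^sub>F N in sequentially. ennreal K < (\<Sum>n<N. f n)"
        using lim True by (intro order_tendstoD(1)[where y = "\<infinity>"]) auto
      then show ?thesis
      proof eventually_elim
        case (elim N)
        have "neg_exp (\<Sum>n<N. f n) \<le> neg_exp (ennreal K)" using elim by (intro neg_exp_antimono) simp
        also have "\<dots> = exp (- K)" by (subst neg_exp_ennreal) (auto simp: K_def)
        also have "\<dots> < exp (ln e)" by (simp add: K_def)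
        finally show ?case using that neg_exp_nonneg by simp
      qed
    qed
    then show ?thesis using True by (simp add: tendsto_iff dist_real_def)
  next
    case False
    have *: "(\<Sum>n<N. f n) \<noteq> \<infinity>" for N
    proof
      assume "(\<Sum>n<N. f n) = \<infinity>"
      moreover have "(\<Sum>n<N. f n) \<le> (\<Sum>n. f n)" by (intro sum_le_suminf) auto
      ultimately show False using False by (simp only: infinity_ennreal_def top_unique)
    qed
    have "(\<lambda>N. exp (- enn2real (\<Sum>n<N. f n))) \<longlonglongrightarrow> exp (- enn2real (\<Sum>n. f n))"
    proof (intro tendsto_exp tendsto_minus tendsto_enn2real)
      have eq: "ennreal (enn2real (\<Sum>n. f n)) = (\<Sum>n. f n)" using False by (simp add: less_top)
      show "(\<lambda>N. \<Sum>n<N. f n) \<longlonglongrightarrow> ennreal (enn2real (\<Sum>n. f n))" unfolding eq by (rule lim)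
    qed simp
    then show ?thesis using False * by (simp add: neg_exp_def)
  qed
  then show ?thesis by (simp add: prod_neg_exp)
qed

section \<open>The sigma-algebra generated by void events\<close>

text \<open>Only emptiness of regions is recorded, not counts: crossing events turn out to be built
  from hitting events, and void events form a generator closed under intersection.\<close>

definition void_algebra :: "'a::topological_space set measure" where
  "void_algebra = sigma UNIV {{S. S \<inter> A = {}} | A. A \<in> sets borel}"

lemma space_void_algebra [simp]: "space void_algebra = UNIV"
  by (simp add: void_algebra_def space_measure_of_conv)

lemma sets_void_algebra:
  "sets void_algebra = sigma_sets UNIV {{S. S \<inter> A = {}} | A. A \<in> sets borel}"
  by (simp add: void_algebra_def)

lemma void_in_void_algebra: "A \<in> sets borel \<Longrightarrow> {S. S \<inter> A = {}} \<in> sets void_algebra"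
  by (auto simp: sets_void_algebra)

lemma hit_in_void_algebra: "A \<in> sets borel \<Longrightarrow> {S. S \<inter> A \<noteq> {}} \<in> sets void_algebra"
  using sets.compl_sets[OF void_in_void_algebra[of A]] by (simp add: Compl_eq_Diff_UNIV[symmetric] Collect_neg_eq)

text \<open>Avoiding \<open>A\<close> and avoiding \<open>B\<close> together means avoiding
  \<open>A \<union> B\<close>. Equality of two laws can therefore be checked on void events.\<close>

lemma Int_stable_void: "Int_stable {{S. S \<inter> A = {}} | A. A \<in> sets borel}"
proof (rule Int_stableI)
  fix E F :: "'a set set" assume "E \<in> {{S. S \<inter> A = {}} | A. A \<in> sets borel}" "F \<in> {{S. S \<inter> A = {}} | A. A \<in> sets borel}"
  then obtain A B where "A \<in> sets borel" "B \<in> sets borel" "E = {S. S \<inter> A = {}}" "F = {S. S \<inter> B = {}}"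
    by auto
  moreover have "{S. S \<inter> A = {}} \<inter> {S. S \<inter> B = {}} = {S. S \<inter> (A \<union> B) = {}}" by auto
  ultimately show "E \<inter> F \<in> {{S. S \<inter> A = {}} | A. A \<in> sets borel}" by auto
qed

lemma measurable_void_algebraI:
  assumes "\<And>A. A \<in> sets borel \<Longrightarrow> {x \<in> space N. f x \<inter> A = {}} \<in> sets N"
  shows "f \<in> measurable N void_algebra"
  unfolding void_algebra_def
  using assms by (intro measurable_measure_of) (auto simp: vimage_def Int_def conj_commute)

lemma measurable_Int_void_algebra:
  "U \<in> sets borel \<Longrightarrow> (\<lambda>S. S \<inter> U) \<in> measurable void_algebra void_algebra"
  by (intro measurable_void_algebraI) (auto simp: Int_assoc intro!: void_in_void_algebra)

lemma measurable_image_void_algebra: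
  assumes "f \<in> borel_measurable borel"
  shows "(\<lambda>S. f ` S) \<in> measurable void_algebra void_algebra"
proof (intro measurable_void_algebraI)
  fix A assume "A \<in> sets (borel :: 'b measure)"
  then have "f -` A \<in> sets borel" using measurable_sets[OF assms] by simp
  then have "{S. S \<inter> f -` A = {}} \<in> sets void_algebra" by (rule void_in_void_algebra)
  moreover have "{S. S \<inter> f -` A = {}} = {S \<in> space void_algebra. f ` S \<inter> A = {}}" by auto
  ultimately show "{S \<in> space void_algebra. f ` S \<inter> A = {}} \<in> sets void_algebra" by simp
qed

section \<open>Processes described by their void probabilities\<close>

text \<open>Keeping void probabilities only lets the notion pass to unions of independent levels,
  where coinciding points would spoil counts.\<close>

locale void_process = prob_space M for M :: "'w measure" +
  fixes \<eta> :: "'w \<Rightarrow> 'a::topological_space set" and \<Lambda> :: "'a measure"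
  assumes sets_intensity: "sets \<Lambda> = sets borel"
    and void_event: "A \<in> sets borel \<Longrightarrow> {\<omega> \<in> space M. \<eta> \<omega> \<inter> A = {}} \<in> events"
    and prob_void: "A \<in> sets borel \<Longrightarrow>
      prob {\<omega> \<in> space M. \<eta> \<omega> \<inter> A = {}} = neg_exp (emeasure \<Lambda> A)"
begin

lemma measurable_process [measurable]: "\<eta> \<in> measurable M void_algebra"
  by (intro measurable_void_algebraI void_event)

lemma process_event: "E \<in> sets void_algebra \<Longrightarrow> {\<omega> \<in> space M. \<eta> \<omega> \<in> E} \<in> events"
  using measurable_sets[OF measurable_process, of E] unfolding vimage_def Collect_conj_eq
  by (simp add: Int_commute)

lemma prob_hit:
  assumes "A \<in> sets borel"
  shows "prob {\<omega> \<in> space M. \<eta> \<omega> \<inter> A \<noteq> {}} = 1 - neg_exp (emeasure \<Lambda> A)"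
  using prob_neg[OF void_event[OF assms]] prob_void[OF assms] by simp

lemma emeasure_hit_le:
  assumes "A \<in> sets borel"
  shows "emeasure M {\<omega> \<in> space M. \<eta> \<omega> \<inter> A \<noteq> {}} \<le> emeasure \<Lambda> A"
  using one_minus_neg_exp_le[of "emeasure \<Lambda> A"] prob_hit[OF assms]
  by (simp add: emeasure_eq_measure)

text \<open>Renyi's theorem: the law of the process is determined by its void probabilities.\<close>

lemma prob_image_eq:
  assumes f: "f \<in> borel_measurable borel" and inv: "distr \<Lambda> borel f = \<Lambda>" and E: "E \<in> sets void_algebra"
  shows "prob {\<omega> \<in> space M. f ` \<eta> \<omega> \<in> E} = prob {\<omega> \<in> space M. \<eta> \<omega> \<in> E}"
proof -
  have m: "(\<lambda>\<omega>. f ` \<eta> \<omega>) \<in> measurable M void_algebra"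
    by (rule measurable_compose[OF measurable_process measurable_image_void_algebra[OF f]])
  let ?G = "{{S. S \<inter> A = {}} | A. A \<in> sets borel} :: 'a set set set"
  have "distr M void_algebra (\<lambda>\<omega>. f ` \<eta> \<omega>) = distr M void_algebra \<eta>"
  proof (rule measure_eqI_generator_eq[OF Int_stable_void, where A = "\<lambda>_. UNIV"])
    fix X assume "X \<in> ?G"
    then obtain A where A: "A \<in> sets borel" and X: "X = {S. S \<inter> A = {}}" by auto
    have fA: "f -` A \<in> sets borel" using measurable_sets[OF f A] by simp
    have "emeasure \<Lambda> A = emeasure (distr \<Lambda> borel f) A" by (simp add: inv)
    also have "\<dots> = emeasure \<Lambda> (f -` A)"
      using A f sets_intensity by (subst emeasure_distr) (auto simp: sets_eq_imp_space_eq cong: measurable_cong_sets)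
    finally have L: "emeasure \<Lambda> A = emeasure \<Lambda> (f -` A)" .
    have "emeasure (distr M void_algebra (\<lambda>\<omega>. f ` \<eta> \<omega>)) X
        = emeasure M {\<omega> \<in> space M. \<eta> \<omega> \<inter> f -` A = {}}"
      using m by (subst emeasure_distr) (auto simp: X intro!: void_in_void_algebra A arg_cong[where f = "emeasure M"])
    also have "\<dots> = emeasure M {\<omega> \<in> space M. \<eta> \<omega> \<inter> A = {}}"
      using prob_void[OF fA] prob_void[OF A] L by (simp add: emeasure_eq_measure)
    also have "\<dots> = emeasure (distr M void_algebra \<eta>) X"
      by (subst emeasure_distr) (auto simp: X intro!: void_in_void_algebra A arg_cong[where f = "emeasure M"])
    finally show "emeasure (distr M void_algebra (\<lambda>\<omega>. f ` \<eta> \<omega>)) X = emeasure (distr M void_algebra \<eta>) X" .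
  next
    \<comment> \<open>The whole space is the void event of the empty region.\<close>
    show "range (\<lambda>_. UNIV) \<subseteq> ?G" by auto
    fix i :: nat
    show "emeasure (distr M void_algebra (\<lambda>\<omega>. f ` \<eta> \<omega>)) UNIV \<noteq> \<infinity>"
      using m by (subst emeasure_distr) (auto simp: sets.top[of void_algebra, simplified] emeasure_eq_measure)
  qed (auto simp: sets_void_algebra)
  then have "measure (distr M void_algebra (\<lambda>\<omega>. f ` \<eta> \<omega>)) E = measure (distr M void_algebra \<eta>) E"
    by simp
  then show ?thesis
    using E m measurable_process by (simp add: measure_distr vimage_def Int_def conj_commute)
qed

text \<open>For void events inside \<open>U\<close> and \<open>V\<close> this holds because
  \<Lambda> adds over disjoint sets and \<open>neg_exp\<close> turns sums into products.
  Independence then extends from these intersection-stable families to the sigma-algebras they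
  generate.\<close>

lemma prob_disjoint_regions:
  assumes U: "U \<in> sets borel" and V: "V \<in> sets borel" and UV: "U \<inter> V = {}"
    and E: "E \<in> sets void_algebra" and F: "F \<in> sets void_algebra"
  shows "prob {\<omega> \<in> space M. \<eta> \<omega> \<inter> U \<in> E \<and> \<eta> \<omega> \<inter> V \<in> F} =
    prob {\<omega> \<in> space M. \<eta> \<omega> \<inter> U \<in> E} * prob {\<omega> \<in> space M. \<eta> \<omega> \<inter> V \<in> F}"
proof -
  define \<G> where "\<G> W = {{\<omega> \<in> space M. \<eta> \<omega> \<inter> W \<inter> A = {}} | A. A \<in> sets borel}" for W
  have G_events: "\<G> W \<subseteq> events" if "W \<in> sets borel" for W
    using that by (auto simp: \<G>_def Int_assoc intro!: void_event)
  have G_stable: "Int_stable (\<G> W)" for W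
  proof (rule Int_stableI)
    fix a b assume "a \<in> \<G> W" "b \<in> \<G> W"
    then obtain A B where "A \<in> sets borel" "B \<in> sets borel"
      "a = {\<omega> \<in> space M. \<eta> \<omega> \<inter> W \<inter> A = {}}" "b = {\<omega> \<in> space M. \<eta> \<omega> \<inter> W \<inter> B = {}}"
      by (auto simp: \<G>_def)
    moreover have "{\<omega> \<in> space M. \<eta> \<omega> \<inter> W \<inter> A = {}} \<inter> {\<omega> \<in> space M. \<eta> \<omega> \<inter> W \<inter> B = {}}
      = {\<omega> \<in> space M. \<eta> \<omega> \<inter> W \<inter> (A \<union> B) = {}}" by auto
    ultimately show "a \<inter> b \<in> \<G> W" unfolding \<G>_def by (auto intro: sets.Un)
  qed
  \<comment> \<open>Preimages under restriction to \<open>W\<close> commute with complements and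
    countable unions, so it suffices that generators go to generators.\<close>
  have G_sigma: "{\<omega> \<in> space M. \<eta> \<omega> \<inter> W \<in> X} \<in> sigma_sets (space M) (\<G> W)"
    if "X \<in> sets void_algebra" for W X
    using that unfolding sets_void_algebra
  proof (induction rule: sigma_sets.induct)
    case (Basic a)
    then show ?case by (auto simp: \<G>_def)
  next
    case Empty
    then show ?case by (auto simp: sigma_sets.Empty)
  next
    case (Compl a)
    have "{\<omega> \<in> space M. \<eta> \<omega> \<inter> W \<in> UNIV - a} = space M - {\<omega> \<in> space M. \<eta> \<omega> \<inter> W \<in> a}" by auto
    then show ?case using sigma_sets.Compl[OF Compl.IH] by simp
  next
    case (Union a)
    have "{\<omega> \<in> space M. \<eta> \<omega> \<inter> W \<in> (\<Union>i. a i)} = (\<Union>i. {\<omega> \<in> space M. \<eta> \<omega> \<inter> W \<in> a i})" by auto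
    then show ?case using sigma_sets.Union[OF Union.IH] by simp
  qed
  have "indep_set (\<G> U) (\<G> V)"
  proof (rule indep_setI)
    fix a b assume "a \<in> \<G> U" "b \<in> \<G> V"
    then obtain A B where AB: "A \<in> sets borel" "B \<in> sets borel"
      and a: "a = {\<omega> \<in> space M. \<eta> \<omega> \<inter> (U \<inter> A) = {}}" and b: "b = {\<omega> \<in> space M. \<eta> \<omega> \<inter> (V \<inter> B) = {}}"
      by (auto simp: \<G>_def Int_assoc)
    have "a \<inter> b = {\<omega> \<in> space M. \<eta> \<omega> \<inter> (U \<inter> A \<union> V \<inter> B) = {}}" by (auto simp: a b)
    moreover have "emeasure \<Lambda> (U \<inter> A \<union> V \<inter> B) = emeasure \<Lambda> (U \<inter> A) + emeasure \<Lambda> (V \<inter> B)"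
      using AB U V UV by (intro plus_emeasure[symmetric]) (auto simp: sets_intensity)
    ultimately show "prob (a \<inter> b) = prob a * prob b"
      using AB U V by (simp add: prob_void a b neg_exp_add)
  qed (use G_events U V in auto)
  then have "indep_set (sigma_sets (space M) (\<G> U)) (sigma_sets (space M) (\<G> V))"
    by (rule indep_set_sigma_sets) (rule G_stable)+
  from indep_setD[OF this G_sigma[OF E] G_sigma[OF F]]
  have "prob ({\<omega> \<in> space M. \<eta> \<omega> \<inter> U \<in> E} \<inter> {\<omega> \<in> space M. \<eta> \<omega> \<inter> V \<in> F}) =
    prob {\<omega> \<in> space M. \<eta> \<omega> \<inter> U \<in> E} * prob {\<omega> \<in> space M. \<eta> \<omega> \<inter> V \<in> F}" .
  moreover have "{\<omega> \<in> space M. \<eta> \<omega> \<inter> U \<in> E} \<inter> {\<omega> \<in> space M. \<eta> \<omega> \<inter> V \<in> F} =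
    {\<omega> \<in> space M. \<eta> \<omega> \<inter> U \<in> E \<and> \<eta> \<omega> \<inter> V \<in> F}" by auto
  ultimately show ?thesis by simp
qed

end

section \<open>Crossings by balls\<close>

text \<open>The path is stopped when it first reaches the outer sphere. By the intermediate value
  theorem the stopped path meets the inner sphere, and its final piece from there stays in the
  closed ball.\<close>

lemma path_crossing:
  fixes g :: "real \<Rightarrow> 'a::real_normed_vector"
  assumes g: "path g" and a: "dist x (pathstart g) \<le> a" and ab: "a < b" "0 < b"
    and b: "b \<le> dist x (pathfinish g)"
  obtains h where "path h" "path_image h \<subseteq> path_image g \<inter> cball x b"
    "pathstart h \<in> sphere x a" "pathfinish h \<in> sphere x b"
proof -
  obtain h where h: "path h" "pathstart h = pathstart g" "path_image h \<subseteq> path_image g"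
    "path_image h - {pathfinish h} \<subseteq> interior (ball x b)" "pathfinish h \<in> frontier (ball x b)"
    using exists_path_subpath_to_frontier[OF g, of "ball x b"] a ab b by (auto simp: mem_ball)
  have fin: "dist x (h 1) = b"
    using h(5) ab by (simp add: frontier_ball pathfinish_def)
  have "continuous_on {0..1} (\<lambda>t. dist x (h t))"
    using h(1) by (intro continuous_intros) (simp add: path_def)
  then obtain t where t: "0 \<le> t" "t \<le> 1" "dist x (h t) = a"
    using IVT'[of "\<lambda>t. dist x (h t)" 0 a 1] fin a ab h(2) by (auto simp: pathstart_def)
  have sub: "path_image (subpath t 1 h) \<subseteq> path_image h"
    using t by (intro path_image_subpath_subset) auto
  have "path_image h \<subseteq> cball x b"
    using h(4) fin by (auto simp: pathfinish_def)
  with sub h(3) t fin h(1) show ?thesis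
    by (intro that[of "subpath t 1 h"]) auto
qed

lemma joined_in_mono: "joined_in S A B \<Longrightarrow> S \<subseteq> T \<Longrightarrow> joined_in T A B"
  unfolding joined_in_def by blast

lemma joined_in_translation:
  fixes x :: "'a::real_normed_vector"
  shows "joined_in ((\<lambda>y. y - x) ` S) ((\<lambda>y. y - x) ` A) ((\<lambda>y. y - x) ` B) \<longleftrightarrow> joined_in S A B"
proof -
  have *: "joined_in ((\<lambda>y. y - x) ` S) ((\<lambda>y. y - x) ` A) ((\<lambda>y. y - x) ` B)"
    if "joined_in S A B" for x :: 'a and S A B
  proof -
    obtain g where g: "path g" "path_image g \<subseteq> S" "pathstart g \<in> A" "pathfinish g \<in> B"
      using \<open>joined_in S A B\<close> unfolding joined_in_def by blast
    then show ?thesis unfolding joined_in_def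
      by (intro exI[of _ "\<lambda>t. g t - x"])
         (auto simp: path_def path_image_def pathstart_def pathfinish_def intro!: continuous_intros)
  qed
  show ?thesis
    using *[of S A B x] *[of "(\<lambda>y. y - x) ` S" "(\<lambda>y. y - x) ` A" "(\<lambda>y. y - x) ` B" "-x"]
    by (auto simp: image_image)
qed

section \<open>Boolean sets and measurability of crossing events\<close>

lemma boolean_set_mono: "S \<subseteq> T \<Longrightarrow> boolean_set S \<subseteq> boolean_set T"
  unfolding boolean_set_def by blast

lemma open_boolean_set: "open (boolean_set S)"
  unfolding boolean_set_def by (intro open_UN) auto

lemma mem_boolean_set: "p \<in> boolean_set S \<longleftrightarrow> (\<exists>c r. (c, r) \<in> S \<and> dist c p < r)"
  unfolding boolean_set_def by (force simp: mem_ball)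

text \<open>One countable dense set \<open>D\<close> serves all configurations. A point of a ball of
  \<open>S\<close> lies in some \<open>ball q t\<close> with \<open>(q, t)\<close> in
  \<open>D\<close> that fits inside that ball with room to spare, and this fitting is an open
  condition on \<open>(c, r)\<close>.\<close>

lemma boolean_set_countable_cover:
  "\<exists>D. countable D \<and> (\<forall>S :: ((real ^ 'd) \<times> real) set. boolean_set S =
     (\<Union>(q, t) \<in> {(q, t) \<in> D. S \<inter> {(c, r). dist c q + t < r} \<noteq> {}}. ball q t))"
proof -
  obtain D :: "((real ^ 'd) \<times> real) set" where D: "countable D"
    and dense: "\<And>X. open X \<Longrightarrow> X \<noteq> {} \<Longrightarrow> \<exists>d\<in>D. d \<in> X"
    using countable_dense_exists by blast
  have "boolean_set S = (\<Union>(q, t) \<in> {(q, t) \<in> D. S \<inter> {(c, r). dist c q + t < r} \<noteq> {}}. ball q t)" for S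
  proof (intro equalityI subsetI)
    fix p assume "p \<in> boolean_set S"
    then obtain c r where cr: "(c, r) \<in> S" "dist c p < r" by (auto simp: mem_boolean_set)
    let ?X = "{z. dist (fst z) p < snd z \<and> dist c (fst z) + snd z < r}"
    have "open ?X"
      by (intro open_Collect_conj open_Collect_less continuous_intros)
    \<comment> \<open>Half of the slack \<open>r - dist c p\<close>, taken as radius around
      \<open>p\<close> itself, shows that this open set is nonempty.\<close>
    moreover have "(p, (r - dist c p) / 2) \<in> ?X" using cr by (auto simp: field_simps)
    ultimately obtain d where d: "d \<in> D" "d \<in> ?X" using dense by blast
    then show "p \<in> (\<Union>(q, t) \<in> {(q, t) \<in> D. S \<inter> {(c, r). dist c q + t < r} \<noteq> {}}. ball q t)"
      using cr by (cases d) (auto intro!: bexI[of _ d])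
  next
    fix p assume "p \<in> (\<Union>(q, t) \<in> {(q, t) \<in> D. S \<inter> {(c, r). dist c q + t < r} \<noteq> {}}. ball q t)"
    then obtain q t c r where "dist q p < t" "(c, r) \<in> S" "dist c q + t < r" by auto
    then show "p \<in> boolean_set S"
      using dist_triangle[of c p q] by (force simp: mem_boolean_set)
  qed
  with D show ?thesis by blast
qed

text \<open>The path is compact, hence covered by finitely many of countably many fixed balls, and
  whether a fixed ball lies well inside some ball of the configuration is a hitting event.\<close>

lemma joined_in_void_algebra:
  "{S. joined_in (boolean_set S) A B} \<in> sets (void_algebra :: ((real ^ 'd) \<times> real) set measure)"
proof -
  obtain D :: "((real ^ 'd) \<times> real) set" where D: "countable D"
    and cover: "\<And>S. boolean_set S =
      (\<Union>(q, t) \<in> {(q, t) \<in> D. S \<inter> {(c, r). dist c q + t < r} \<noteq> {}}. ball q t)"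
    using boolean_set_countable_cover by blast
  define hits where "hits = (\<lambda>(q::real^'d, t). {S. S \<inter> {(c, r). dist c q + t < r} \<noteq> {}})"
  \<comment> \<open>Whether the balls listed in \<open>F\<close> join \<open>A\<close> to
    \<open>B\<close> does not involve \<open>S\<close>. The crossing event is thus a countable union
    of finite intersections of hitting events, for arbitrary sets \<open>A\<close> and
    \<open>B\<close>.\<close>
  define \<F> where "\<F> = {F. finite F \<and> F \<subseteq> D \<and> joined_in (\<Union>(q, t) \<in> F. ball q t) A B}"
  have hits: "hits z \<in> sets void_algebra" for z
  proof -
    have "open {(c, r). dist c (fst z) + snd z < r}"
      unfolding case_prod_beta by (intro open_Collect_less continuous_intros)
    then show ?thesis by (auto simp: hits_def case_prod_beta intro!: hit_in_void_algebra)
  qed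
  have "countable \<F>"
    using countable_Collect_finite_subset[OF D] by (rule countable_subset[rotated]) (auto simp: \<F>_def)
  moreover have "{S. \<forall>z\<in>F. S \<in> hits z} \<in> sets void_algebra" if "F \<in> \<F>" for F
  proof -
    have "{S \<in> space void_algebra. \<forall>z\<in>F. S \<in> hits z} \<in> sets void_algebra"
      using that hits by (intro sets.sets_Collect_finite_All) (simp_all add: \<F>_def)
    then show ?thesis by simp
  qed
  ultimately have "(\<Union>F\<in>\<F>. {S. \<forall>z\<in>F. S \<in> hits z}) \<in> sets void_algebra"
    by (rule sets.countable_UN'')
  moreover have "{S. joined_in (boolean_set S) A B} = (\<Union>F\<in>\<F>. {S. \<forall>z\<in>F. S \<in> hits z})"
  proof (intro equalityI subsetI; clarify)
    fix S assume "joined_in (boolean_set S) A B"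
    then obtain g where g: "path g" "path_image g \<subseteq> boolean_set S" "pathstart g \<in> A" "pathfinish g \<in> B"
      unfolding joined_in_def by blast
    let ?D = "{z \<in> D. S \<in> hits z}"
    have "path_image g \<subseteq> (\<Union>z\<in>?D. case z of (q, t) \<Rightarrow> ball q t)"
      using g(2) unfolding cover by (force simp: hits_def)
    then obtain F where F: "F \<subseteq> ?D" "finite F" "path_image g \<subseteq> (\<Union>z\<in>F. case z of (q, t) \<Rightarrow> ball q t)"
      using compactE_image[OF compact_path_image[OF g(1)], of ?D "\<lambda>z. case z of (q, t) \<Rightarrow> ball q t"]
      by (auto split: prod.splits)
    then have "F \<in> \<F>" using g unfolding \<F>_def joined_in_def by auto
    then show "S \<in> (\<Union>F\<in>\<F>. {S. \<forall>z\<in>F. S \<in> hits z})" using F by auto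
  next
    fix S F assume F: "F \<in> \<F>" "\<forall>z\<in>F. S \<in> hits z"
    then have "(\<Union>(q, t)\<in>F. ball q t) \<subseteq> boolean_set S"
      unfolding cover by (fastforce simp: \<F>_def hits_def)
    then show "joined_in (boolean_set S) A B"
      using F by (auto simp: \<F>_def intro: joined_in_mono)
  qed
  ultimately show ?thesis by simp
qed

text \<open>Only balls centred near the annulus are used, so that local crossings of distant annuli are
  independent.\<close>

definition local_crossing :: "((real ^ 'd) \<times> real) set \<Rightarrow> real ^ 'd \<Rightarrow> real \<Rightarrow> bool" where
  "local_crossing S x a \<longleftrightarrow>
     joined_in (boolean_set (S \<inter> ball x (10 * a) \<times> UNIV)) (sphere x a) (sphere x (8 * a))"

text \<open>The centre is compared with the radius \<open>r\<close> rather than with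
  \<open>a\<close>. One event thus covers both the large balls centred in
  \<open>ball 0 (100 * a)\<close> and those centred far away that reach
  \<open>cball 0 (8 * a)\<close>.\<close>

definition large_balls :: "real \<Rightarrow> ((real ^ 'd) \<times> real) set" where
  "large_balls a = {(c, r). a \<le> r \<and> norm c \<le> 100 * r}"

section \<open>Local crossings: translation, localisation and cascade\<close>

text \<open>Moves the event from \<open>x\<close> to the origin, so that a translation invariant law
  gives it a probability that does not depend on \<open>x\<close>.\<close>

lemma local_crossing_translation:
  "local_crossing S x a \<longleftrightarrow> local_crossing ((\<lambda>(c, r). (c - x, r)) ` S) 0 a"
proof -
  have sph: "(\<lambda>y. y - x) ` sphere x b = sphere 0 b" for b :: real
    using sphere_translation_subtract[of x x b] by simp
  have "boolean_set ((\<lambda>(c, r). (c - x, r)) ` S \<inter> ball 0 (10 * a) \<times> UNIV)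
    = (\<lambda>y. y - x) ` boolean_set (S \<inter> ball x (10 * a) \<times> UNIV)"
  proof (intro equalityI subsetI)
    fix p assume "p \<in> boolean_set ((\<lambda>(c, r). (c - x, r)) ` S \<inter> ball 0 (10 * a) \<times> UNIV)"
    then obtain c r where "(c, r) \<in> S" "norm (c - x) < 10 * a" "dist (c - x) p < r"
      by (auto simp: mem_boolean_set)
    then have "p + x \<in> boolean_set (S \<inter> ball x (10 * a) \<times> UNIV)"
      unfolding mem_boolean_set
      by (intro exI[of _ c] exI[of _ r]) (auto simp: dist_norm norm_minus_commute algebra_simps)
    then show "p \<in> (\<lambda>y. y - x) ` boolean_set (S \<inter> ball x (10 * a) \<times> UNIV)"
      by (intro image_eqI[of _ _ "p + x"]) auto
  next
    fix p assume "p \<in> (\<lambda>y. y - x) ` boolean_set (S \<inter> ball x (10 * a) \<times> UNIV)"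
    then obtain c r where "(c, r) \<in> S" "dist x c < 10 * a" "dist c (p + x) < r"
      by (auto simp: mem_boolean_set)
    then show "p \<in> boolean_set ((\<lambda>(c, r). (c - x, r)) ` S \<inter> ball 0 (10 * a) \<times> UNIV)"
      unfolding mem_boolean_set
      by (intro exI[of _ "c - x"] exI[of _ r])
         (auto simp: dist_norm norm_minus_commute algebra_simps intro!: image_eqI[of _ _ "(c, r)"])
  qed
  then show ?thesis
    unfolding local_crossing_def
    using joined_in_translation[of x "boolean_set (S \<inter> ball x (10 * a) \<times> UNIV)" "sphere x a" "sphere x (8 * a)"]
    by (simp add: sph)
qed

text \<open>On its way to radius \<open>8 * a\<close> the path meets radius \<open>2 * a\<close>.
  With \<open>r = 2 * a\<close> this is the crossing from radius \<open>r / 2\<close> to radius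
  \<open>r\<close> whose probability is assumed to tend to 0.\<close>

lemma local_crossing_joined:
  assumes "local_crossing S 0 a" "0 < a"
  shows "joined_in (boolean_set S) (sphere 0 a) (sphere 0 (2 * a))"
proof -
  obtain g where g: "path g" "path_image g \<subseteq> boolean_set (S \<inter> ball 0 (10 * a) \<times> UNIV)"
    "pathstart g \<in> sphere 0 a" "pathfinish g \<in> sphere 0 (8 * a)"
    using assms unfolding local_crossing_def joined_in_def by blast
  obtain h where "path h" "path_image h \<subseteq> path_image g \<inter> cball 0 (2 * a)"
    "pathstart h \<in> sphere 0 a" "pathfinish h \<in> sphere 0 (2 * a)"
    using path_crossing[OF g(1), of 0 a "2 * a"] g assms by auto
  moreover have "boolean_set (S \<inter> ball 0 (10 * a) \<times> UNIV) \<subseteq> boolean_set S"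
    by (rule boolean_set_mono) auto
  ultimately show ?thesis using g unfolding joined_in_def by blast
qed

text \<open>The path is cut down to the annulus. By \<open>near\<close>, every ball that meets
  \<open>cball x (8 * a)\<close> is centred in the region that \<open>local_crossing\<close> looks
  at, so these balls alone cover the piece.\<close>

lemma local_crossing_of_path:
  assumes g: "path g" "path_image g \<subseteq> boolean_set S" and a: "0 < a"
    and start: "dist x (pathstart g) \<le> a" and fin: "8 * a \<le> dist x (pathfinish g)"
    and near: "\<And>c r p. (c, r) \<in> S \<Longrightarrow> dist c p < r \<Longrightarrow> dist x p \<le> 8 * a \<Longrightarrow> dist x c < 10 * a"
  shows "local_crossing S x a"
proof -
  obtain h where h: "path h" "path_image h \<subseteq> path_image g \<inter> cball x (8 * a)"
    "pathstart h \<in> sphere x a" "pathfinish h \<in> sphere x (8 * a)"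
    using path_crossing[OF g(1), of x a "8 * a"] start fin a by auto
  have "path_image h \<subseteq> boolean_set (S \<inter> ball x (10 * a) \<times> UNIV)"
  proof
    fix p assume p: "p \<in> path_image h"
    then obtain c r where "(c, r) \<in> S" "dist c p < r"
      using h(2) g(2) by (auto simp: mem_boolean_set subset_iff)
    moreover have "dist x p \<le> 8 * a" using h(2) p by auto
    ultimately have "(c, r) \<in> S \<inter> ball x (10 * a) \<times> UNIV" "dist c p < r"
      using near[of c r p] by auto
    then show "p \<in> boolean_set (S \<inter> ball x (10 * a) \<times> UNIV)"
      unfolding mem_boolean_set by blast
  qed
  then show ?thesis using h unfolding local_crossing_def joined_in_def by blast
qed

text \<open>The path starts within \<open>a\<close> of some \<open>a *\<^sub>R k\<close> and ends
  within \<open>a\<close> of some \<open>a *\<^sub>R l\<close>. The spheres that carry its two ends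
  are \<open>70 * a\<close> apart, so from either net point the opposite end is farther than
  \<open>8 * a\<close>, and the path crosses the annulus around both.\<close>

lemma local_crossing_cascade:
  assumes G: "local_crossing S 0 (10 * a)" and a: "0 < a" and W: "S \<inter> large_balls a = {}"
    and K: "sphere 0 10 \<subseteq> (\<Union>k\<in>K. ball k 1)" and L: "sphere 0 80 \<subseteq> (\<Union>l\<in>L. ball l 1)"
    and KL: "\<And>k. k \<in> K \<Longrightarrow> norm k = 10" "\<And>l. l \<in> L \<Longrightarrow> norm l = 80"
  shows "\<exists>k\<in>K. \<exists>l\<in>L. local_crossing S (a *\<^sub>R k) a \<and> local_crossing S (a *\<^sub>R l) a"
proof -
  \<comment> \<open>A local crossing at scale \<open>10 * a\<close> uses only balls centred within
    \<open>10 * (10 * a)\<close> of the origin.\<close>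
  let ?S = "S \<inter> ball 0 (100 * a) \<times> UNIV"
  obtain g where g: "path g" "path_image g \<subseteq> boolean_set ?S"
    "pathstart g \<in> sphere 0 (10 * a)" "pathfinish g \<in> sphere 0 (80 * a)"
    using G unfolding local_crossing_def joined_in_def by auto
  have sc: "dist (a *\<^sub>R k) p < a" if "dist k ((1 / a) *\<^sub>R p) < 1" for k p :: "real ^ 'd"
  proof -
    have "dist (a *\<^sub>R k) (a *\<^sub>R ((1 / a) *\<^sub>R p)) = a * dist k ((1 / a) *\<^sub>R p)"
      using a unfolding dist_norm scaleR_diff_right[symmetric] norm_scaleR by simp
    also have "\<dots> < a * 1" using that a by (intro mult_strict_left_mono) auto
    finally show ?thesis using a by simp
  qed
  have "(1 / a) *\<^sub>R pathstart g \<in> sphere 0 10" "(1 / a) *\<^sub>R pathfinish g \<in> sphere 0 80"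
    using g a by auto
  with K L obtain k l where k: "k \<in> K" "dist k ((1 / a) *\<^sub>R pathstart g) < 1"
    and l: "l \<in> L" "dist l ((1 / a) *\<^sub>R pathfinish g) < 1"
    by (force simp: subset_iff)
  have n: "norm (a *\<^sub>R k) = 10 * a" "norm (a *\<^sub>R l) = 80 * a" using KL k l a by auto
  \<comment> \<open>A ball centred in \<open>ball 0 (100 * a)\<close> with radius at least
    \<open>a\<close> would belong to \<open>large_balls a\<close>. So \<open>r < a\<close>, and the
    centre is within \<open>9 * a\<close> of \<open>x\<close>.\<close>
  have near: "dist x c < 10 * a" if "(c, r) \<in> ?S" "dist c p < r" "dist x p \<le> 8 * a" for x c p r
  proof -
    have "r < a" using that W a by (force simp: large_balls_def)
    then show ?thesis using that dist_triangle2[of x c p] a by simp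
  qed
  have mono: "local_crossing S x a" if "local_crossing ?S x a" for x
    using that unfolding local_crossing_def by (rule joined_in_mono) (intro boolean_set_mono, auto)
  have "local_crossing ?S (a *\<^sub>R k) a"
  proof (rule local_crossing_of_path[OF g(1,2) a])
    show "dist (a *\<^sub>R k) (pathstart g) \<le> a" using sc[OF k(2)] by simp
    show "8 * a \<le> dist (a *\<^sub>R k) (pathfinish g)"
      using norm_triangle_sub[of "pathfinish g" "a *\<^sub>R k"] n g(4) a by (simp add: dist_norm norm_minus_commute)
  qed (use near in auto)
  \<comment> \<open>Around the outer net point the path is run backwards, so that it starts close to
    that point.\<close>
  moreover have "local_crossing ?S (a *\<^sub>R l) a"
  proof (rule local_crossing_of_path[OF path_reversepath[THEN iffD2, OF g(1)] _ a])
    show "dist (a *\<^sub>R l) (pathstart (reversepath g)) \<le> a" using sc[OF l(2)] by simp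
    show "8 * a \<le> dist (a *\<^sub>R l) (pathfinish (reversepath g))"
      using norm_triangle_sub[of "a *\<^sub>R l" "pathstart g"] n g(3) a by (simp add: dist_norm norm_minus_commute)
  qed (use near g in auto)
  ultimately show ?thesis using mono k(1) l(1) by blast
qed

section \<open>Bounds on the diameter of the component of the origin\<close>

text \<open>Components of an open set are path components. A point of the component at norm at least
  \<open>8 * a\<close> would give a path from 0 and hence a local crossing at scale
  \<open>a\<close>.\<close>

lemma origin_diameter_le:
  assumes nG: "\<not> local_crossing S 0 a" and a: "0 < a" and W: "S \<inter> large_balls a = {}"
  shows "origin_diameter (boolean_set S) \<le> ennreal (16 * a)"
proof -
  have small: "norm x < 8 * a" if "x \<in> connected_component_set (boolean_set S) 0" for x
  proof (rule ccontr)
    assume x: "\<not> norm x < 8 * a"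
    have "path_component (boolean_set S) 0 x"
      using that open_path_connected_component[OF open_boolean_set, of S] by simp
    then obtain g where g: "path g" "path_image g \<subseteq> boolean_set S" "pathstart g = 0" "pathfinish g = x"
      unfolding path_component_def by blast
    have "local_crossing S 0 a"
    proof (rule local_crossing_of_path[OF g(1,2) a])
      fix c r p assume *: "(c, r) \<in> S" "dist c p < r" "dist 0 p \<le> 8 * a"
      show "dist 0 c < 10 * a"
      proof (rule ccontr)
        assume c: "\<not> dist 0 c < 10 * a"
        \<comment> \<open>To come within \<open>8 * a\<close> of the origin from distance at least
          \<open>10 * a\<close>, a ball needs \<open>r > 2 * a\<close>; then
          \<open>norm c < r + 8 * a < 5 * r\<close>.\<close>
        then have "norm c \<le> 100 * r" "a \<le> r"
          using * norm_triangle_sub[of c p] a by (auto simp: dist_norm)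
        with * W show False by (auto simp: large_balls_def)
      qed
    qed (use g x a in auto)
    with nG show False ..
  qed
  have "dist x y \<le> 16 * a"
    if "x \<in> connected_component_set (boolean_set S) 0" "y \<in> connected_component_set (boolean_set S) 0" for x y
    using small[OF that(1)] small[OF that(2)] norm_triangle_ineq4[of x y] by (simp add: dist_norm)
  then show ?thesis
    unfolding origin_diameter_def ediameter_def by (auto intro!: SUP_least ennreal_leI)
qed

text \<open>The ball contains the origin and is connected, so it lies in the component. Distances
  from its centre to points at distance \<open>t < r\<close> along a coordinate axis have supremum
  \<open>r\<close>.\<close>

lemma origin_diameter_ge:
  fixes c :: "real ^ 'd"
  assumes "(c, r) \<in> S" "norm c < r"
  shows "ennreal r \<le> origin_diameter (boolean_set S)"
proof -
  have r: "0 < r" using assms norm_ge_zero[of c] by linarith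
  have B: "ball c r \<subseteq> boolean_set S" using assms unfolding boolean_set_def by auto
  have C: "ball c r \<subseteq> connected_component_set (boolean_set S) 0"
    using assms B by (intro connected_component_maximal) (auto simp: dist_norm)
  let ?e = "axis undefined 1 :: real ^ 'd"
  have below: "ennreal t \<le> origin_diameter (boolean_set S)" if "0 < t" "t < r" for t
  proof -
    have "c \<in> ball c r" "c + t *\<^sub>R ?e \<in> ball c r"
      using that r by (auto simp: dist_norm norm_axis_1)
    with C have m: "c \<in> connected_component_set (boolean_set S) 0"
      "c + t *\<^sub>R ?e \<in> connected_component_set (boolean_set S) 0" by blast+
    have "ennreal t = ennreal (dist c (c + t *\<^sub>R ?e))" using that by (simp add: dist_norm norm_axis_1)
    also have "\<dots> \<le> origin_diameter (boolean_set S)"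
      unfolding origin_diameter_def ediameter_def by (rule SUP_upper2[OF m(1)], rule SUP_upper[OF m(2)])
    finally show ?thesis .
  qed
  show ?thesis
  proof (rule ccontr)
    assume "\<not> ennreal r \<le> origin_diameter (boolean_set S)"
    then have lt: "origin_diameter (boolean_set S) < ennreal r" by simp
    then obtain u where u: "origin_diameter (boolean_set S) = ennreal u" "0 \<le> u" "u < r"
      by (cases "origin_diameter (boolean_set S)") (auto simp: ennreal_less_iff)
    have "ennreal ((u + r) / 2) \<le> ennreal u"
      using below[of "(u + r) / 2"] u r by simp
    then show False using u r by (simp add: ennreal_le_iff)
  qed
qed

section \<open>Sums along powers of ten\<close>

lemma ex_power_10_bracket:
  assumes "1 \<le> (y::real)"
  obtains K :: nat where "10 ^ K \<le> y" "y < 10 ^ Suc K"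
proof -
  obtain N :: nat where N: "y < 10 ^ N" using real_arch_pow[of 10 y] by auto
  define m where "m = (LEAST m::nat. y < 10 ^ m)"
  have m: "y < 10 ^ m" unfolding m_def using N by (rule LeastI)
  then have "m \<noteq> 0" using assms by (cases m) auto
  then obtain K where K: "m = Suc K" by (cases m) auto
  then have "\<not> y < 10 ^ K" unfolding m_def using not_less_Least[of K] by (metis lessI m_def)
  with m K show ?thesis by (intro that[of K]) auto
qed

lemma power_powr: "0 < x \<Longrightarrow> (x ^ k :: real) powr s = (x powr s) ^ k"
  by (simp add: powr_realpow[symmetric] powr_powr mult.commute powr_power)

text \<open>With its converse below, this turns moments into weighted sums of tails over the scales
  \<open>10 ^ k\<close>. The sum is geometric with ratio above 1, hence at most a constant times its
  last term, which is at most \<open>y powr s\<close>.\<close>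

lemma sum_decadic_powr_le:
  assumes s: "0 < s"
  obtains C :: real where "0 < C"
    "\<And>y. (\<Sum>k. ennreal ((10 powr s) ^ k) * indicator {10 ^ k..} y) \<le> ennreal (C * y powr s) * indicator {1..} y"
proof -
  define b where "b = 10 powr s"
  have b: "1 < b" using s by (simp add: b_def)
  have "(\<Sum>k. ennreal (b ^ k) * indicator {10 ^ k..} y) \<le> ennreal (b / (b - 1) * y powr s) * indicator {1..} y"
    for y :: real
  proof (cases "1 \<le> y")
    case True
    then obtain K :: nat where K: "10 ^ K \<le> y" "y < 10 ^ Suc K" by (rule ex_power_10_bracket)
    have "(\<Sum>k. ennreal (b ^ k) * indicator {10 ^ k..} y) = (\<Sum>k<Suc K. ennreal (b ^ k) * indicator {10 ^ k..} y)"
    proof (rule suminf_finite)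
      fix k assume "k \<notin> {..<Suc K}"
      then have "(10::real) ^ Suc K \<le> 10 ^ k" by (intro power_increasing) auto
      then have "y < 10 ^ k" using K by linarith
      then show "ennreal (b ^ k) * indicator {10 ^ k..} y = 0" by auto
    qed simp
    also have "\<dots> \<le> (\<Sum>k<Suc K. ennreal (b ^ k))"
      by (intro sum_mono) (auto simp: indicator_def)
    also have "\<dots> = ennreal (\<Sum>k<Suc K. b ^ k)" using b by (intro sum_ennreal) auto
    also have "\<dots> \<le> ennreal (b / (b - 1) * y powr s)"
    proof (rule ennreal_leI)
      have "(\<Sum>k<Suc K. b ^ k) = (b ^ Suc K - 1) / (b - 1)" using b by (subst geometric_sum) auto
      also have "\<dots> \<le> b * b ^ K / (b - 1)" using b by (intro divide_right_mono) auto
      also have "b ^ K = (10 ^ K) powr s" by (simp add: b_def power_powr)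
      also have "b * (10 ^ K) powr s / (b - 1) \<le> b * y powr s / (b - 1)"
        using b s K by (intro divide_right_mono mult_left_mono powr_mono2) auto
      finally show "(\<Sum>k<Suc K. b ^ k) \<le> b / (b - 1) * y powr s" by simp
    qed
    finally show ?thesis using True by simp
  next
    case False
    have "(indicator {10 ^ k..} y :: ennreal) = 0" for k
    proof -
      have "y < 10 ^ k" using False one_le_power[of "10::real" k] by linarith
      then show ?thesis by simp
    qed
    then show ?thesis by simp
  qed
  moreover have "0 < b / (b - 1)" using b by simp
  ultimately show ?thesis unfolding b_def by (intro that)
qed

text \<open>The largest power of ten not exceeding \<open>y\<close> is greater than
  \<open>y / 10\<close>, and its term alone suffices.\<close>

lemma sum_decadic_powr_ge:
  assumes s: "0 < s" and y: "1 \<le> y"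
  shows "ennreal ((1 / 10) powr s * y powr s) \<le> (\<Sum>k. ennreal ((10 powr s) ^ k) * indicator {10 ^ k..} y)"
proof -
  obtain K :: nat where K: "10 ^ K \<le> y" "y < 10 ^ Suc K" using y by (rule ex_power_10_bracket)
  have "(1 / 10) powr s * y powr s = (y / 10) powr s" using y by (simp add: powr_mult[symmetric])
  also have "\<dots> \<le> (10 ^ K) powr s" using K y s by (intro powr_mono2) auto
  also have "\<dots> = (10 powr s) ^ K" by (rule power_powr) simp
  finally have le: "ennreal ((1 / 10) powr s * y powr s) \<le> ennreal ((10 powr s) ^ K) * indicator {10 ^ K..} y"
    using K by (simp add: ennreal_leI)
  have "f K \<le> (\<Sum>k. f k)" for f :: "nat \<Rightarrow> ennreal"
    using sum_le_suminf[of f "{K}"] by simp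
  from order_trans[OF le this[of "\<lambda>k. ennreal ((10 powr s) ^ k) * indicator {10 ^ k..} y"]]
  show ?thesis .
qed

section \<open>A quadratic recursion with summable error\<close>

text \<open>Once \<open>p k\<close> is small, the quadratic term is at most
  \<open>p k / (2 * b)\<close>. The weighted sequence \<open>q\<close> then satisfies
  \<open>q (Suc k) \<le> q k / 2 + h k\<close> with \<open>h\<close> summable, which bounds its
  partial sums.\<close>

lemma summable_of_quadratic_recursion:
  fixes p g :: "nat \<Rightarrow> real"
  assumes p: "\<And>k. 0 \<le> p k" and rec: "\<And>k. p (Suc k) \<le> C * (p k)\<^sup>2 + g k"
    and lim: "p \<longlonglongrightarrow> 0" and b: "0 < b" and g0: "\<And>k. 0 \<le> g k" and g: "summable (\<lambda>k. b ^ k * g k)"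
  shows "summable (\<lambda>k. b ^ k * p k)"
proof -
  \<comment> \<open>\<open>C\<close> may be negative or zero; the threshold for \<open>p\<close>
    below divides by a positive majorant of it.\<close>
  define C' where "C' = \<bar>C\<bar> + 1"
  have C': "0 < C'" "C \<le> C'" by (auto simp: C'_def)
  have "\<forall>\<^sub>F k in sequentially. p k < 1 / (2 * b * C')"
    using lim b C' by (intro order_tendstoD(2)) auto
  then obtain N where N: "\<And>k. N \<le> k \<Longrightarrow> p k < 1 / (2 * b * C')"
    by (auto simp: eventually_sequentially)
  define q where "q k = b ^ (N + k) * p (N + k)" for k
  define h where "h k = b * (b ^ (N + k) * g (N + k))" for k
  have q0: "0 \<le> q k" for k using p b by (simp add: q_def)
  have h0: "0 \<le> h k" for k using g0 b by (simp add: h_def)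
  have sh: "summable h" unfolding h_def using summable_ignore_initial_segment[OF g, of N]
    by (intro summable_mult) (simp add: add.commute)
  have step: "q (Suc k) \<le> q k / 2 + h k" for k
  proof -
    have "C * (p (N + k))\<^sup>2 \<le> C' * (p (N + k))\<^sup>2" using C' by (intro mult_right_mono) auto
    also have "\<dots> = (C' * p (N + k)) * p (N + k)" by (simp add: power2_eq_square)
    also have "\<dots> \<le> (1 / (2 * b)) * p (N + k)"
      using N[of "N + k"] C' b p by (intro mult_right_mono) (auto simp: field_simps)
    finally have "p (Suc (N + k)) \<le> 1 / (2 * b) * p (N + k) + g (N + k)" using rec[of "N + k"] by linarith
    then have "b * b ^ (N + k) * p (Suc (N + k)) \<le> b * b ^ (N + k) * (1 / (2 * b) * p (N + k) + g (N + k))"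
      using b by (intro mult_left_mono) auto
    also have "\<dots> = b ^ (N + k) * p (N + k) / 2 + b * (b ^ (N + k) * g (N + k))"
      using b by (simp add: field_simps)
    finally show ?thesis by (simp add: q_def h_def mult.assoc)
  qed
  have bound: "(\<Sum>k<n. q k) \<le> 2 * (q 0 + suminf h)" for n
  proof (cases n)
    case 0
    then show ?thesis using q0[of 0] suminf_nonneg[OF sh h0] by simp
  next
    case (Suc m)
    have "(\<Sum>k<Suc m. q k) = q 0 + (\<Sum>k<m. q (Suc k))" by (rule sum.lessThan_Suc_shift)
    also have "\<dots> \<le> q 0 + (\<Sum>k<m. q k / 2 + h k)" by (intro add_left_mono sum_mono step)
    also have "\<dots> = q 0 + (\<Sum>k<m. q k) / 2 + (\<Sum>k<m. h k)" by (simp add: sum.distrib sum_divide_distrib)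
    \<comment> \<open>Adding the nonnegative term \<open>q m\<close> / 2 puts the same sum on both
      sides, so that half of it can be absorbed on the left.\<close>
    also have "\<dots> \<le> q 0 + (\<Sum>k<Suc m. q k) / 2 + suminf h"
      using q0[of m] sum_le_suminf[OF sh, of "{..<m}"] h0 by (simp add: add_mono)
    finally have "X \<le> 2 * (q 0 + suminf h)" if "X = (\<Sum>k<Suc m. q k)" for X
      using that by (simp add: field_simps)
    then show ?thesis unfolding Suc by blast
  qed
  have "summable q" by (rule summableI_nonneg_bounded[OF q0 bound])
  moreover have "q = (\<lambda>k. b ^ (k + N) * p (k + N))" by (auto simp: q_def add.commute)
  ultimately have "summable (\<lambda>k. b ^ (k + N) * p (k + N))" by metis
  then show ?thesis by (rule summable_iff_shift[THEN iffD1])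
qed

section \<open>The intensity of the superposed process\<close>

definition rescale :: "real \<Rightarrow> nat \<Rightarrow> (real ^ 'd) \<times> real \<Rightarrow> (real ^ 'd) \<times> real" where
  "rescale \<rho> n = (\<lambda>(c, r). ((1 / \<rho> ^ n) *\<^sub>R c, (1 / \<rho> ^ n) * r))"

definition superposition :: "real \<Rightarrow> (nat \<Rightarrow> ((real ^ 'd) \<times> real) set) \<Rightarrow> ((real ^ 'd) \<times> real) set" where
  "superposition \<rho> \<eta> = (\<Union>n. rescale \<rho> n ` \<eta> n)"

lemma multiscale_set_superposition:
  assumes "0 < \<rho>"
  shows "multiscale_set \<rho> \<eta> = boolean_set (superposition \<rho> \<eta>)"
proof -
  have ball_image: "(\<lambda>x. (1 / \<rho> ^ n) *\<^sub>R x) ` ball c r = ball ((1 / \<rho> ^ n) *\<^sub>R c) ((1 / \<rho> ^ n) * r)" for n r and c :: "real ^ 'd"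
    using assms by (subst ball_scale) auto
  show ?thesis
    unfolding multiscale_set_def boolean_set_def superposition_def rescale_def image_UN
      case_prod_beta UN_UN_flatten image_image fst_conv snd_conv ball_image by blast
qed

text \<open>This is the sum over \<open>n\<close> of the images of
  \<open>boolean_intensity \<nu>\<close> under \<open>rescale \<rho> n\<close>. As a single image of
  a product with counting measure it is a measure by construction.\<close>

definition multiscale_intensity :: "real \<Rightarrow> real measure \<Rightarrow> ((real ^ 'd) \<times> real) measure" where
  "multiscale_intensity \<rho> \<nu> =
     distr (count_space UNIV \<Otimes>\<^sub>M boolean_intensity \<nu>) borel (\<lambda>(n, z). rescale \<rho> n z)"

lemma emeasure_lborel_translate:
  fixes B :: "'c::euclidean_space set"
  assumes "B \<in> sets borel"
  shows "emeasure lborel {c. c - v \<in> B} = emeasure lborel B"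
proof -
  have "emeasure lborel B = emeasure (distr lborel borel ((+) (- v))) B" by (simp add: lborel_distr_plus)
  also have "\<dots> = emeasure lborel {c. c - v \<in> B}"
    using assms by (subst emeasure_distr) (auto simp: vimage_def)
  finally show ?thesis by simp
qed

section \<open>The multiscale intensity and its translation invariance\<close>

locale radius_measure = finite_measure \<nu> for \<nu> :: "real measure" +
  assumes sets_radius: "sets \<nu> = sets (restrict_space borel {0<..})"
begin

lemma space_radius: "space \<nu> = {0<..}"
  using sets_eq_imp_space_eq[OF sets_radius] by (simp add: space_restrict_space)

lemma measurable_radius: "f \<in> borel_measurable borel \<Longrightarrow> f \<in> measurable \<nu> borel"
  unfolding measurable_cong_sets[OF sets_radius refl] by (rule measurable_restrict_space1)

sublocale lborel_radius: pair_sigma_finite lborel \<nu> by standard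

lemma space_boolean_intensity: "space (boolean_intensity \<nu>) = UNIV \<times> {0<..}"
  by (simp add: boolean_intensity_def space_pair_measure space_radius)

lemma measurable_rescale: "rescale \<rho> n \<in> measurable (boolean_intensity \<nu>) borel"
proof -
  have [measurable]: "snd \<in> borel_measurable (boolean_intensity \<nu>)"
    unfolding boolean_intensity_def
    using measurable_compose[OF measurable_snd measurable_radius[of "\<lambda>x. x"]] by simp
  have [measurable]: "fst \<in> borel_measurable (boolean_intensity \<nu> :: ((real ^ 'b) \<times> real) measure)"
    unfolding boolean_intensity_def
    using measurable_fst[of "lborel :: (real ^ 'b) measure" \<nu>] by (simp cong: measurable_cong_sets)
  show ?thesis unfolding rescale_def case_prod_beta by measurable
qed

lemma measurable_rescale_pair:
  "(\<lambda>(n, z). rescale \<rho> n z) \<in> measurable (count_space UNIV \<Otimes>\<^sub>M boolean_intensity \<nu>) borel"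
  by (rule measurable_pair_measure_countable1) (auto intro: measurable_rescale)

lemma vimage_rescale: "A \<in> sets borel \<Longrightarrow>
    rescale \<rho> n -` A \<inter> space (boolean_intensity \<nu>) \<in> sets (boolean_intensity \<nu>)"
  by (rule measurable_sets[OF measurable_rescale])

lemma sets_multiscale_intensity: "sets (multiscale_intensity \<rho> \<nu>) = sets borel"
  by (simp add: multiscale_intensity_def)

lemma emeasure_multiscale_intensity:
  assumes A: "A \<in> sets borel"
  shows "emeasure (multiscale_intensity \<rho> \<nu>) A =
    (\<Sum>n. emeasure (boolean_intensity \<nu>) (rescale \<rho> n -` A \<inter> space (boolean_intensity \<nu>)))"
proof -
  interpret B: sigma_finite_measure "boolean_intensity \<nu> :: ((real ^ 'a) \<times> real) measure"
    unfolding boolean_intensity_def by unfold_locales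
  let ?P = "count_space UNIV \<Otimes>\<^sub>M boolean_intensity \<nu> :: (nat \<times> (real ^ 'a) \<times> real) measure"
  have "emeasure (multiscale_intensity \<rho> \<nu>) A = emeasure ?P ((\<lambda>(n, z). rescale \<rho> n z) -` A \<inter> space ?P)"
    unfolding multiscale_intensity_def by (rule emeasure_distr[OF measurable_rescale_pair A])
  also have "\<dots> = (\<integral>\<^sup>+ n. emeasure (boolean_intensity \<nu>) (Pair n -` ((\<lambda>(n, z). rescale \<rho> n z) -` A \<inter> space ?P)) \<partial>count_space UNIV)"
    by (rule B.emeasure_pair_measure_alt[OF measurable_sets[OF measurable_rescale_pair A]])
  also have "\<dots> = (\<Sum>n. emeasure (boolean_intensity \<nu>) (Pair n -` ((\<lambda>(n, z). rescale \<rho> n z) -` A \<inter> space ?P)))"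
    by (rule nn_integral_count_space_nat)
  also have "(\<lambda>n. Pair n -` ((\<lambda>(n, z). rescale \<rho> n z) -` A \<inter> space ?P))
    = (\<lambda>n. rescale \<rho> n -` A \<inter> space (boolean_intensity \<nu>))"
    by (auto simp: space_pair_measure)
  finally show ?thesis .
qed

text \<open>Integrating over the centres first leaves Lebesgue measures of sets of centres, for
  which translations and volumes of balls are explicit.\<close>

lemma emeasure_level:
  assumes A: "A \<in> sets borel"
  shows "emeasure (boolean_intensity \<nu>) (rescale \<rho> n -` A \<inter> space (boolean_intensity \<nu>)) =
    (\<integral>\<^sup>+ r. emeasure lborel {c. ((1 / \<rho> ^ n) *\<^sub>R c, (1 / \<rho> ^ n) * r) \<in> A} \<partial>\<nu>)"
proof -
  have "emeasure (boolean_intensity \<nu>) (rescale \<rho> n -` A \<inter> space (boolean_intensity \<nu>)) =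
    (\<integral>\<^sup>+ r. emeasure lborel ((\<lambda>c. (c, r)) -` (rescale \<rho> n -` A \<inter> space (boolean_intensity \<nu>))) \<partial>\<nu>)"
    using vimage_rescale[OF A, of \<rho> n] unfolding boolean_intensity_def
    by (rule lborel_radius.emeasure_pair_measure_alt2)
  also have "\<dots> = (\<integral>\<^sup>+ r. emeasure lborel {c. ((1 / \<rho> ^ n) *\<^sub>R c, (1 / \<rho> ^ n) * r) \<in> A} \<partial>\<nu>)"
    by (intro nn_integral_cong arg_cong[where f = "emeasure lborel"])
       (auto simp: space_boolean_intensity space_radius rescale_def)
  finally show ?thesis .
qed

lemma emeasure_multiscale_intensity_levels:
  "A \<in> sets borel \<Longrightarrow> emeasure (multiscale_intensity \<rho> \<nu>) A =
    (\<Sum>n. \<integral>\<^sup>+ r. emeasure lborel {c. ((1 / \<rho> ^ n) *\<^sub>R c, (1 / \<rho> ^ n) * r) \<in> A} \<partial>\<nu>)"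
  by (simp add: emeasure_multiscale_intensity emeasure_level)

text \<open>A shift by \<open>x\<close> after rescaling at level \<open>n\<close> is a shift of the
  original centres by \<open>\<rho> ^ n *\<^sub>R x\<close>, which preserves Lebesgue
  measure.\<close>

lemma multiscale_intensity_translation:
  assumes \<rho>: "0 < \<rho>"
  shows "distr (multiscale_intensity \<rho> \<nu>) borel (\<lambda>(c, r). (c - x, r)) = multiscale_intensity \<rho> \<nu>"
proof (rule measure_eqI)
  show "sets (distr (multiscale_intensity \<rho> \<nu>) borel (\<lambda>(c, r). (c - x, r))) = sets (multiscale_intensity \<rho> \<nu>)"
    by (simp add: sets_multiscale_intensity)
  fix A assume "A \<in> sets (distr (multiscale_intensity \<rho> \<nu>) borel (\<lambda>(c, r). (c - x, r)))"
  then have A: "A \<in> sets borel" by simp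
  let ?f = "\<lambda>(c, r :: real). (c - x, r)"
  have f: "?f \<in> borel_measurable borel"
    unfolding case_prod_beta by (intro borel_measurable_continuous_onI continuous_intros)
  have fA: "?f -` A \<in> sets borel" using measurable_sets[OF f A] by simp
  have "emeasure (distr (multiscale_intensity \<rho> \<nu>) borel ?f) A = emeasure (multiscale_intensity \<rho> \<nu>) (?f -` A)"
    using A f by (subst emeasure_distr)
      (auto simp: multiscale_intensity_def cong: measurable_cong_sets)
  also have "\<dots> = emeasure (multiscale_intensity \<rho> \<nu>) A"
    unfolding emeasure_multiscale_intensity_levels[OF fA] emeasure_multiscale_intensity_levels[OF A]
  proof (intro suminf_cong nn_integral_cong)
    fix n r
    let ?B = "{c. ((1 / \<rho> ^ n) *\<^sub>R c, (1 / \<rho> ^ n) * r) \<in> A}"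
    have "(\<lambda>c :: real ^ 'a. ((1 / \<rho> ^ n) *\<^sub>R c, (1 / \<rho> ^ n) * r)) \<in> borel_measurable borel"
      by (intro borel_measurable_continuous_onI continuous_intros)
    from measurable_sets[OF this A] have B: "?B \<in> sets borel" by (simp add: vimage_def)
    have "{c. ((1 / \<rho> ^ n) *\<^sub>R c, (1 / \<rho> ^ n) * r) \<in> ?f -` A} = {c. c - \<rho> ^ n *\<^sub>R x \<in> ?B}"
      using \<rho> by (auto simp: scaleR_diff_right)
    then show "emeasure lborel {c. ((1 / \<rho> ^ n) *\<^sub>R c, (1 / \<rho> ^ n) * r) \<in> ?f -` A} = emeasure lborel ?B"
      using emeasure_lborel_translate[OF B] by simp
  qed
  finally show "emeasure (distr (multiscale_intensity \<rho> \<nu>) borel ?f) A = emeasure (multiscale_intensity \<rho> \<nu>) A" .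
qed

end

lemma suminf_swap_ennreal:
  fixes f :: "nat \<Rightarrow> nat \<Rightarrow> ennreal"
  shows "(\<Sum>k. \<Sum>n. f k n) = (\<Sum>n. \<Sum>k. f k n)"
proof -
  have "(\<Sum>k. \<Sum>n. f k n) = (\<integral>\<^sup>+ k. (\<Sum>n. f k n) \<partial>count_space UNIV)"
    by (rule nn_integral_count_space_nat[symmetric])
  also have "\<dots> = (\<Sum>n. \<integral>\<^sup>+ k. f k n \<partial>count_space UNIV)"
    by (rule nn_integral_suminf) simp
  finally show ?thesis by (simp add: nn_integral_count_space_nat)
qed

lemma suminf_const_ennreal_eq_top: "(\<Sum>n. 1 :: ennreal) = \<infinity>"
proof -
  have "(\<Sum>n. 1 :: ennreal) = (\<integral>\<^sup>+ n. 1 \<partial>count_space (UNIV :: nat set))"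
    by (rule nn_integral_count_space_nat[symmetric])
  then show ?thesis by (simp add: emeasure_count_space_infinite)
qed

section \<open>Intensities of large balls and of balls covering the origin\<close>

lemma borel_large_balls: "large_balls a \<in> sets borel"
proof -
  have "closed {z :: (real ^ 'a) \<times> real. a \<le> snd z \<and> norm (fst z) \<le> 100 * snd z}"
    by (intro closed_Collect_conj closed_Collect_le continuous_intros)
  then show ?thesis unfolding large_balls_def case_prod_beta by (rule borel_closed)
qed

definition covering_balls :: "real \<Rightarrow> ((real ^ 'd) \<times> real) set" where
  "covering_balls a = {(c, r). a \<le> r \<and> norm c < r}"

lemma borel_covering_balls: "covering_balls a \<in> sets borel"
proof -
  have "{z :: (real ^ 'a) \<times> real. a \<le> snd z} \<inter> {z. norm (fst z) < snd z} \<in> sets borel"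
    by (intro sets.Int borel_closed borel_open closed_Collect_le open_Collect_less continuous_intros)
  moreover have "{z :: (real ^ 'a) \<times> real. a \<le> snd z} \<inter> {z. norm (fst z) < snd z} = covering_balls a"
    by (auto simp: covering_balls_def)
  ultimately show ?thesis by simp
qed

context radius_measure
begin

text \<open>The condition \<open>norm c \<le> 100 * r\<close> is invariant under scaling, so at
  every level the original centres fill a ball of radius \<open>100 * r\<close>; the level enters
  only through \<open>a \<le> r / \<rho> ^ n\<close>.\<close>

lemma emeasure_large_balls:
  assumes \<rho>: "0 < \<rho>" and a: "0 < a"
  shows "emeasure (multiscale_intensity \<rho> \<nu>) (large_balls a :: ((real ^ 'd) \<times> real) set) =
    (\<integral>\<^sup>+ r. (\<Sum>n. ennreal (unit_ball_vol CARD('d) * (100 * r) ^ CARD('d)) * indicator {a..} (r / \<rho> ^ n)) \<partial>\<nu>)"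
proof -
  have "emeasure (multiscale_intensity \<rho> \<nu>) (large_balls a :: ((real ^ 'd) \<times> real) set) =
    (\<Sum>n. \<integral>\<^sup>+ r. ennreal (unit_ball_vol CARD('d) * (100 * r) ^ CARD('d)) * indicator {a..} (r / \<rho> ^ n) \<partial>\<nu>)"
    unfolding emeasure_multiscale_intensity_levels[OF borel_large_balls]
  proof (intro suminf_cong nn_integral_cong)
    fix n r assume "r \<in> space \<nu>"
    then have r: "0 < r" by (simp add: space_radius)
    have "{c :: real ^ 'd. ((1 / \<rho> ^ n) *\<^sub>R c, (1 / \<rho> ^ n) * r) \<in> large_balls a} =
      (if a \<le> r / \<rho> ^ n then cball 0 (100 * r) else {})"
      using \<rho> by (auto simp: large_balls_def field_simps)
    then show "emeasure lborel {c :: real ^ 'd. ((1 / \<rho> ^ n) *\<^sub>R c, (1 / \<rho> ^ n) * r) \<in> large_balls a} =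
      ennreal (unit_ball_vol CARD('d) * (100 * r) ^ CARD('d)) * indicator {a..} (r / \<rho> ^ n)"
      using r by (simp add: emeasure_cball)
  qed
  also have "\<dots> = (\<integral>\<^sup>+ r. (\<Sum>n. ennreal (unit_ball_vol CARD('d) * (100 * r) ^ CARD('d)) * indicator {a..} (r / \<rho> ^ n)) \<partial>\<nu>)"
    by (intro nn_integral_suminf[symmetric] measurable_radius) measurable
  finally show ?thesis .
qed

text \<open>Summing over the scales first gives a multiple of
  \<open>(r / \<rho> ^ n) powr s\<close>. Since \<open>s > 0\<close>, this is geometric in the level
  with ratio \<open>\<rho> powr (- s) < 1\<close>; the volume supplies the remaining factor of order
  \<open>r ^ CARD('d)\<close>.\<close>

lemma large_balls_moment:
  assumes \<rho>: "1 < \<rho>" and s: "0 < s"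
    and fin: "(\<integral>\<^sup>+ r\<in>{1..}. ennreal (r powr (real CARD('d) + s)) \<partial>\<nu>) < \<infinity>"
  shows "(\<Sum>k. ennreal ((10 powr s) ^ k) *
    emeasure (multiscale_intensity \<rho> \<nu>) (large_balls (10 ^ k) :: ((real ^ 'd) \<times> real) set)) < \<infinity>"
proof -
  define w where "w r = ennreal (unit_ball_vol CARD('d) * (100 * r) ^ CARD('d))" for r
  have w [measurable]: "w \<in> borel_measurable borel" unfolding w_def by measurable
  obtain C where C: "0 < C"
    "\<And>y. (\<Sum>k. ennreal ((10 powr s) ^ k) * indicator {10 ^ k..} y) \<le> ennreal (C * y powr s) * indicator {1..} y"
    by (rule sum_decadic_powr_le[OF s]) blast
  define q where "q = \<rho> powr (- s)"
  have q: "0 < q" "q < 1" using \<rho> s by (auto simp: q_def powr_less_one)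
  define Q where "Q = (\<Sum>n. ennreal (q ^ n))"
  have Q: "Q < \<infinity>"
  proof -
    have "Q \<noteq> \<top>" unfolding Q_def
      by (rule ennreal_suminf_neq_top[OF summable_geometric]) (use q in auto)
    then show ?thesis by (simp add: less_top)
  qed
  define B where "B = unit_ball_vol CARD('d) * 100 ^ CARD('d) * C"
  have B: "0 \<le> B" using C by (simp add: B_def)
  have pw: "(\<Sum>k. ennreal ((10 powr s) ^ k) * (\<Sum>n. w r * indicator {10 ^ k..} (r / \<rho> ^ n)))
      \<le> (ennreal B * Q) * (ennreal (r powr (real CARD('d) + s)) * indicator {1..} r)"
    if "r \<in> space \<nu>" for r
  proof -
    have r: "0 < r" using that by (simp add: space_radius)
    have "(\<Sum>k. ennreal ((10 powr s) ^ k) * (\<Sum>n. w r * indicator {10 ^ k..} (r / \<rho> ^ n)))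
      = (\<Sum>k. \<Sum>n. w r * (ennreal ((10 powr s) ^ k) * indicator {10 ^ k..} (r / \<rho> ^ n)))"
      by (simp add: ennreal_suminf_cmult[symmetric] ac_simps del: ennreal_suminf_cmult)
    also have "\<dots> = (\<Sum>n. \<Sum>k. w r * (ennreal ((10 powr s) ^ k) * indicator {10 ^ k..} (r / \<rho> ^ n)))"
      by (rule suminf_swap_ennreal)
    also have "\<dots> = (\<Sum>n. w r * (\<Sum>k. ennreal ((10 powr s) ^ k) * indicator {10 ^ k..} (r / \<rho> ^ n)))"
      by simp
    also have "\<dots> \<le> (\<Sum>n. (ennreal B * (ennreal (r powr (real CARD('d) + s)) * indicator {1..} r)) * ennreal (q ^ n))"
    proof (intro suminf_le summableI)
      fix n
      \<comment> \<open>Rescaling shrinks radii, so only original radii at least 1 contribute at the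
        scales \<open>10 ^ k\<close>.\<close>
      have "r / \<rho> ^ n \<le> r" using \<rho> r one_le_power[of \<rho> n] by (simp add: field_simps)
      then have ind: "(indicator {1..} (r / \<rho> ^ n) :: ennreal) \<le> indicator {1..} r"
        by (auto simp: indicator_def)
      have pq: "(r / \<rho> ^ n) powr s = r powr s * q ^ n"
      proof -
        have "(r / \<rho> ^ n) powr s = r powr s / (\<rho> ^ n) powr s" by (rule powr_divide)
        also have "(\<rho> ^ n) powr s = (\<rho> powr s) ^ n" using \<rho> by (intro power_powr) simp
        finally show ?thesis by (simp add: q_def powr_minus power_inverse divide_inverse)
      qed
      have "(\<Sum>k. ennreal ((10 powr s) ^ k) * indicator {10 ^ k..} (r / \<rho> ^ n))
        \<le> ennreal (C * (r / \<rho> ^ n) powr s) * indicator {1..} r"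
        using C(2)[of "r / \<rho> ^ n"] by (rule order_trans) (rule mult_left_mono[OF ind], simp)
      then have "w r * (\<Sum>k. ennreal ((10 powr s) ^ k) * indicator {10 ^ k..} (r / \<rho> ^ n))
        \<le> w r * (ennreal (C * (r / \<rho> ^ n) powr s) * indicator {1..} r)"
        by (rule mult_left_mono) simp
      also have "\<dots> = (w r * ennreal (C * (r / \<rho> ^ n) powr s)) * indicator {1..} r"
        by (simp only: mult.assoc)
      also have "w r * ennreal (C * (r / \<rho> ^ n) powr s) = ennreal (B * r powr (real CARD('d) + s) * q ^ n)"
        using r C q unfolding w_def pq
        by (simp add: ennreal_mult[symmetric] B_def powr_add powr_realpow power_mult_distrib mult_ac)
      also have "ennreal (B * r powr (real CARD('d) + s) * q ^ n) * indicator {1..} r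
        = (ennreal B * (ennreal (r powr (real CARD('d) + s)) * indicator {1..} r)) * ennreal (q ^ n)"
        using B q by (simp add: ennreal_mult mult_ac)
      finally show "w r * (\<Sum>k. ennreal ((10 powr s) ^ k) * indicator {10 ^ k..} (r / \<rho> ^ n))
        \<le> (ennreal B * (ennreal (r powr (real CARD('d) + s)) * indicator {1..} r)) * ennreal (q ^ n)" .
    qed
    also have "\<dots> = (ennreal B * Q) * (ennreal (r powr (real CARD('d) + s)) * indicator {1..} r)"
      by (simp add: Q_def mult_ac)
    finally show ?thesis .
  qed
  have "(\<Sum>k. ennreal ((10 powr s) ^ k) * emeasure (multiscale_intensity \<rho> \<nu>) (large_balls (10 ^ k) :: ((real ^ 'd) \<times> real) set))
    = (\<Sum>k. \<integral>\<^sup>+ r. ennreal ((10 powr s) ^ k) * (\<Sum>n. w r * indicator {10 ^ k..} (r / \<rho> ^ n)) \<partial>\<nu>)"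
    using \<rho> unfolding w_def
    by (intro suminf_cong, subst emeasure_large_balls)
       (auto intro!: nn_integral_cmult[symmetric] measurable_radius)
  also have "\<dots> = (\<integral>\<^sup>+ r. (\<Sum>k. ennreal ((10 powr s) ^ k) * (\<Sum>n. w r * indicator {10 ^ k..} (r / \<rho> ^ n))) \<partial>\<nu>)"
    by (intro nn_integral_suminf[symmetric] measurable_radius) measurable
  also have "\<dots> \<le> (\<integral>\<^sup>+ r. (ennreal B * Q) * (ennreal (r powr (real CARD('d) + s)) * indicator {1..} r) \<partial>\<nu>)"
    by (intro nn_integral_mono pw)
  also have "\<dots> = (ennreal B * Q) * (\<integral>\<^sup>+ r\<in>{1..}. ennreal (r powr (real CARD('d) + s)) \<partial>\<nu>)"
    by (intro nn_integral_cmult measurable_radius) measurable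
  also have "\<dots> < \<infinity>" using fin Q by (simp add: ennreal_mult_less_top)
  finally show ?thesis .
qed

text \<open>Only level 0 is kept; there the centres of the balls of radius \<open>r\<close> that
  cover the origin fill a ball of radius \<open>r\<close>.\<close>

lemma emeasure_covering_balls_ge:
  assumes \<rho>: "0 < \<rho>" and a: "0 < a"
  shows "(\<integral>\<^sup>+ r. ennreal (unit_ball_vol CARD('d) * r ^ CARD('d)) * indicator {a..} r \<partial>\<nu>)
    \<le> emeasure (multiscale_intensity \<rho> \<nu>) (covering_balls a :: ((real ^ 'd) \<times> real) set)"
proof -
  define f where "f n = (\<integral>\<^sup>+ r. emeasure lborel {c :: real ^ 'd. ((1 / \<rho> ^ n) *\<^sub>R c, (1 / \<rho> ^ n) * r) \<in> covering_balls a} \<partial>\<nu>)" for n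
  have "(\<integral>\<^sup>+ r. ennreal (unit_ball_vol CARD('d) * r ^ CARD('d)) * indicator {a..} r \<partial>\<nu>) = f 0"
    unfolding f_def
  proof (intro nn_integral_cong)
    fix r assume "r \<in> space \<nu>"
    then have r: "0 < r" by (simp add: space_radius)
    have "{c :: real ^ 'd. ((1 / \<rho> ^ 0) *\<^sub>R c, (1 / \<rho> ^ 0) * r) \<in> covering_balls a} =
      (if a \<le> r then ball 0 r else {})"
      by (auto simp: covering_balls_def)
    then show "ennreal (unit_ball_vol CARD('d) * r ^ CARD('d)) * indicator {a..} r =
      emeasure lborel {c :: real ^ 'd. ((1 / \<rho> ^ 0) *\<^sub>R c, (1 / \<rho> ^ 0) * r) \<in> covering_balls a}"
      using r by (simp add: emeasure_ball)
  qed
  also have "f 0 \<le> (\<Sum>n. f n)" using sum_le_suminf[of f "{0}"] by simp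
  also have "\<dots> = emeasure (multiscale_intensity \<rho> \<nu>) (covering_balls a :: ((real ^ 'd) \<times> real) set)"
    unfolding f_def by (rule emeasure_multiscale_intensity_levels[OF borel_covering_balls, symmetric])
  finally show ?thesis .
qed

text \<open>Divergence of the weighted intensities comes from the moment. It passes to the hitting
  probabilities because \<open>1 - exp (- x)\<close> is comparable to \<open>x\<close> on bounded
  intervals; unbounded intensities are a separate case.\<close>

lemma covering_balls_divergence:
  assumes \<rho>: "0 < \<rho>" and s: "0 < s"
    and inf: "(\<integral>\<^sup>+ r\<in>{1..}. ennreal (r powr (real CARD('d) + s)) \<partial>\<nu>) = \<infinity>"
  shows "(\<Sum>k. ennreal ((10 powr s) ^ k) *
    ennreal (1 - neg_exp (emeasure (multiscale_intensity \<rho> \<nu>) (covering_balls (10 ^ k) :: ((real ^ 'd) \<times> real) set)))) = \<infinity>"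
    (is "(\<Sum>k. _ * ennreal (1 - neg_exp (?L k))) = \<infinity>")
proof -
  define w where "w r = ennreal (unit_ball_vol CARD('d) * r ^ CARD('d))" for r
  have w [measurable]: "w \<in> borel_measurable borel" unfolding w_def by measurable
  define h where "h k = (\<integral>\<^sup>+ r. w r * indicator {10 ^ k..} r \<partial>\<nu>)" for k :: nat
  have hL: "h k \<le> ?L k" for k
    unfolding h_def w_def using \<rho> by (intro emeasure_covering_balls_ge) auto
  have h_sum: "(\<Sum>k. ennreal ((10 powr s) ^ k) * h k) = \<infinity>"
  proof -
    define B where "B = unit_ball_vol CARD('d) * (1 / 10) powr s"
    have B: "0 < B" by (simp add: B_def)
    have "\<infinity> = ennreal B * (\<integral>\<^sup>+ r\<in>{1..}. ennreal (r powr (real CARD('d) + s)) \<partial>\<nu>)"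
      using B inf by (simp add: ennreal_mult_top)
    also have "\<dots> = (\<integral>\<^sup>+ r. ennreal B * (ennreal (r powr (real CARD('d) + s)) * indicator {1..} r) \<partial>\<nu>)"
      by (intro nn_integral_cmult[symmetric] measurable_radius) measurable
    also have "\<dots> \<le> (\<integral>\<^sup>+ r. (\<Sum>k. ennreal ((10 powr s) ^ k) * (w r * indicator {10 ^ k..} r)) \<partial>\<nu>)"
    proof (intro nn_integral_mono)
      fix r assume "r \<in> space \<nu>"
      then have r: "0 < r" by (simp add: space_radius)
      show "ennreal B * (ennreal (r powr (real CARD('d) + s)) * indicator {1..} r)
        \<le> (\<Sum>k. ennreal ((10 powr s) ^ k) * (w r * indicator {10 ^ k..} r))"
      proof (cases "1 \<le> r")
        case True
        have "ennreal B * ennreal (r powr (real CARD('d) + s)) = w r * ennreal ((1 / 10) powr s * r powr s)"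
          using r by (simp add: w_def B_def ennreal_mult[symmetric] powr_add powr_realpow mult_ac)
        also have "\<dots> \<le> w r * (\<Sum>k. ennreal ((10 powr s) ^ k) * indicator {10 ^ k..} r)"
          by (intro mult_left_mono sum_decadic_powr_ge s True) simp
        also have "\<dots> = (\<Sum>k. ennreal ((10 powr s) ^ k) * (w r * indicator {10 ^ k..} r))"
          by (simp add: ennreal_suminf_cmult[symmetric] ac_simps del: ennreal_suminf_cmult)
        finally show ?thesis using True by simp
      qed simp
    qed
    also have "\<dots> = (\<Sum>k. \<integral>\<^sup>+ r. ennreal ((10 powr s) ^ k) * (w r * indicator {10 ^ k..} r) \<partial>\<nu>)"
      by (intro nn_integral_suminf measurable_radius) measurable
    also have "\<dots> = (\<Sum>k. ennreal ((10 powr s) ^ k) * h k)"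
      unfolding h_def by (intro suminf_cong nn_integral_cmult measurable_radius) measurable
    finally show ?thesis by (simp add: top_unique)
  qed
  show ?thesis
  proof (cases "h 0 = \<infinity>")
    case True
    \<comment> \<open>Radii below \<open>10 ^ k\<close> contribute at most \<open>w (10 ^ k)\<close>
      times the finite mass of \<nu>, so the infinite part lies beyond every scale. All hitting
      probabilities are then 1, with weights at least 1.\<close>
    have top: "h k = \<infinity>" for k
    proof (rule ccontr)
      assume "h k \<noteq> \<infinity>"
      have "h 0 \<le> (\<integral>\<^sup>+ r. w (10 ^ k) + w r * indicator {10 ^ k..} r \<partial>\<nu>)"
        unfolding h_def
      proof (intro nn_integral_mono)
        fix r assume "r \<in> space \<nu>"
        then have "0 < r" by (simp add: space_radius)
        then have "w r \<le> w (10 ^ k)" if "r < 10 ^ k"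
          unfolding w_def using that by (intro ennreal_leI mult_left_mono power_mono) auto
        then show "w r * indicator {10 ^ 0..} r \<le> w (10 ^ k) + w r * indicator {10 ^ k..} r"
          by (auto simp: indicator_def add_increasing)
      qed
      also have "\<dots> = w (10 ^ k) * emeasure \<nu> (space \<nu>) + h k"
        unfolding h_def by (subst nn_integral_add) (auto intro!: measurable_radius)
      also have "\<dots> < \<infinity>"
        using \<open>h k \<noteq> \<infinity>\<close> by (simp add: w_def ennreal_mult_eq_top_iff less_top[symmetric] emeasure_eq_measure)
      finally show False using True by simp
    qed
    have "?L k = \<infinity>" for k using hL[of k] top[of k] by (simp add: top_unique)
    then have "(\<Sum>k. ennreal ((10 powr s) ^ k) * ennreal (1 - neg_exp (?L k))) = (\<Sum>k. ennreal ((10 powr s) ^ k))"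
      by simp
    also have "\<dots> \<ge> (\<Sum>k::nat. 1)"
      using s by (intro suminf_le summableI) (auto simp: ge_one_powr_ge_zero one_le_power)
    finally show ?thesis by (simp add: suminf_const_ennreal_eq_top top_unique)
  next
    case False
    then obtain H where H: "h 0 = ennreal H" "0 \<le> H" by (cases "h 0") auto
    \<comment> \<open>From \<open>1 + x \<le> exp x\<close> follows
      \<open>x * exp (- x) \<le> 1 - exp (- x)\<close>, and \<open>x \<le> H\<close> makes the
      factor uniform in \<open>k\<close>.\<close>
    have "ennreal (exp (- H)) * h k \<le> ennreal (1 - neg_exp (?L k))" for k
    proof -
      have "h k \<le> h 0" unfolding h_def
        by (intro nn_integral_mono mult_left_mono) (auto simp: indicator_def intro: order_trans[OF one_le_power[of "10::real" k]])
      then obtain x where x: "h k = ennreal x" "0 \<le> x" "x \<le> H"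
        using H by (cases "h k") (auto simp: top_unique)
      have "exp (- H) * x \<le> exp (- x) * x" using x by (intro mult_right_mono) auto
      also have "\<dots> \<le> 1 - exp (- x)"
        using exp_ge_add_one_self[of x] by (simp add: exp_minus field_simps)
      also have "exp (- x) = neg_exp (h k)" using x by (simp add: neg_exp_ennreal)
      also have "1 - neg_exp (h k) \<le> 1 - neg_exp (?L k)" using neg_exp_antimono[OF hL[of k]] by simp
      finally show ?thesis using x by (simp add: ennreal_mult[symmetric] ennreal_leI)
    qed
    then have "(\<Sum>k. ennreal ((10 powr s) ^ k) * (ennreal (exp (- H)) * h k))
      \<le> (\<Sum>k. ennreal ((10 powr s) ^ k) * ennreal (1 - neg_exp (?L k)))"
      by (intro suminf_le summableI mult_left_mono) auto
    moreover have "(\<Sum>k. ennreal ((10 powr s) ^ k) * (ennreal (exp (- H)) * h k)) = ennreal (exp (- H)) * (\<Sum>k. ennreal ((10 powr s) ^ k) * h k)"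
      by (simp add: ennreal_suminf_cmult[symmetric] ac_simps del: ennreal_suminf_cmult)
    ultimately show ?thesis using h_sum by (simp add: ennreal_mult_top top_unique)
  qed
qed

end

section \<open>From Poisson processes to void probabilities\<close>

context prob_space
begin

text \<open>For finite intensity this is the case \<open>k = 0\<close> of the Poisson law. For
  infinite intensity the region almost surely holds infinitely many points.\<close>

lemma level_void:
  assumes X: "poisson_point_process \<Lambda> X" and B: "B \<in> sets \<Lambda>"
  shows "{S \<in> Pow (space \<Lambda>). S \<inter> B = {}} \<in> sets (configurations \<Lambda>)"
    and "prob {\<omega> \<in> space M. X \<omega> \<inter> B = {}} = neg_exp (emeasure \<Lambda> B)"
proof -
  have np: "num_points B S = 0 \<longleftrightarrow> S \<inter> B = {}" for S
    by (simp add: num_points_def emeasure_count_space_eq_0)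
  have "num_points B -` {0} \<inter> Pow (space \<Lambda>) \<in> sets (configurations \<Lambda>)"
    unfolding configurations_def
    by (intro in_measure_of CollectI exI[of _ B] exI[of _ "{0}"]) (use B in auto)
  moreover have "num_points B -` {0} \<inter> Pow (space \<Lambda>) = {S \<in> Pow (space \<Lambda>). S \<inter> B = {}}"
    using np by auto
  ultimately show "{S \<in> Pow (space \<Lambda>). S \<inter> B = {}} \<in> sets (configurations \<Lambda>)" by simp
  show "prob {\<omega> \<in> space M. X \<omega> \<inter> B = {}} = neg_exp (emeasure \<Lambda> B)"
  proof (cases "emeasure \<Lambda> B = \<infinity>")
    case True
    then have "AE \<omega> in M. num_points B (X \<omega>) = \<infinity>" using X B by (simp add: poisson_point_process_def)
    then have "AE \<omega> in M. \<not> X \<omega> \<inter> B = {}" by eventually_elim (auto simp flip: np)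
    then have "prob {\<omega> \<in> space M. X \<omega> \<inter> B = {}} = 0" by (rule prob_eq_0_AE)
    then show ?thesis using True by simp
  next
    case False
    then have "\<forall>k::nat. prob {\<omega> \<in> space M. num_points B (X \<omega>) = of_nat k} =
        exp (- measure \<Lambda> B) * measure \<Lambda> B ^ k / fact k"
      using X B by (simp add: poisson_point_process_def less_top)
    from spec[OF this, of 0] show ?thesis
      using False np by (simp add: neg_exp_def measure_def)
  qed
qed

text \<open>The superposition avoids \<open>A\<close> exactly when every level avoids its own
  preimage of \<open>A\<close>. Independence gives the product over finitely many levels, and
  continuity from above the limit.\<close>

lemma void_process_superposition:
  fixes \<xi> :: "nat \<Rightarrow> 'a \<Rightarrow> ((real ^ 'd) \<times> real) set"
  assumes "radius_measure \<nu>" and drivers: "independent_boolean_drivers \<nu> \<xi>"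
  shows "void_process M (\<lambda>\<omega>. superposition \<rho> (\<lambda>n. \<xi> n \<omega>)) (multiscale_intensity \<rho> \<nu>)"
proof -
  interpret \<nu>: radius_measure \<nu> by fact
  let ?L = "boolean_intensity \<nu> :: ((real ^ 'd) \<times> real) measure"
  have ppp: "\<And>n. poisson_point_process ?L (\<xi> n)"
    and indep: "indep_vars (\<lambda>_. configurations ?L) \<xi> UNIV"
    using drivers unfolding independent_boolean_drivers_def by auto
  have sub: "\<xi> n \<omega> \<subseteq> space ?L" if "\<omega> \<in> space M" for n \<omega>
    using measurable_space[of "\<xi> n" M "configurations ?L"] ppp[of n] that
    by (auto simp: poisson_point_process_def configurations_def space_measure_of_conv)
  have void: "{\<omega> \<in> space M. superposition \<rho> (\<lambda>n. \<xi> n \<omega>) \<inter> A = {}} \<in> events \<and>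
     prob {\<omega> \<in> space M. superposition \<rho> (\<lambda>n. \<xi> n \<omega>) \<inter> A = {}} = neg_exp (emeasure (multiscale_intensity \<rho> \<nu>) A)"
    if A: "A \<in> sets borel" for A
  proof -
    define B where "B n = rescale \<rho> n -` A \<inter> space ?L" for n
    have B: "B n \<in> sets ?L" for n unfolding B_def by (rule \<nu>.vimage_rescale[OF A])
    define E where "E n = {S \<in> Pow (space ?L). S \<inter> B n = {}}" for n
    have E: "E n \<in> sets (configurations ?L)" for n
      unfolding E_def by (rule level_void(1)[OF ppp B])
    define V where "V n = \<xi> n -` E n \<inter> space M" for n
    have V: "V n \<in> events" for n
      using ppp[of n] E[of n] unfolding V_def poisson_point_process_def by (auto intro: measurable_sets)
    have V_eq: "V n = {\<omega> \<in> space M. \<xi> n \<omega> \<inter> B n = {}}" for n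
      using sub by (auto simp: V_def E_def)
    have PV: "prob (V n) = neg_exp (emeasure ?L (B n))" for n
      unfolding V_eq by (rule level_void(2)[OF ppp B])
    have all: "{\<omega> \<in> space M. superposition \<rho> (\<lambda>n. \<xi> n \<omega>) \<inter> A = {}} = (\<Inter>n. V n)"
      using sub unfolding V_eq superposition_def B_def by (fastforce simp: subset_iff)
    \<comment> \<open>With \<open>Suc N\<close> the index set is never empty; an empty intersection
      would be the universe instead of \<open>space M\<close>.\<close>
    have fin: "prob (\<Inter>n<Suc N. V n) = (\<Prod>n<Suc N. neg_exp (emeasure ?L (B n)))" for N
      using indep_varsD[OF indep, of "{..<Suc N}" E] E unfolding V_def[symmetric] PV
      by auto
    have "(\<lambda>N. prob (\<Inter>n<Suc N. V n)) \<longlonglongrightarrow> prob (\<Inter>N. \<Inter>n<Suc N. V n)"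
      by (rule finite_Lim_measure_decseq[of "\<lambda>N. \<Inter>n<Suc N. V n"])
        (use V in \<open>auto simp: decseq_def intro!: sets.finite_INT\<close>)
    also have "(\<Inter>N. \<Inter>n<Suc N. V n) = (\<Inter>n. V n)" by auto
    finally have "(\<lambda>N. \<Prod>n<Suc N. neg_exp (emeasure ?L (B n))) \<longlonglongrightarrow> prob (\<Inter>n. V n)"
      unfolding fin .
    moreover have "(\<lambda>N. \<Prod>n<Suc N. neg_exp (emeasure ?L (B n))) \<longlonglongrightarrow> neg_exp (\<Sum>n. emeasure ?L (B n))"
      by (rule LIMSEQ_Suc[OF prod_neg_exp_tendsto])
    ultimately have "prob (\<Inter>n. V n) = neg_exp (\<Sum>n. emeasure ?L (B n))" by (rule LIMSEQ_unique)
    then show ?thesis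
      using V by (auto simp: all \<nu>.emeasure_multiscale_intensity[OF A] B_def intro: sets.countable_INT)
  qed
  show ?thesis
    using void by unfold_locales (auto simp: \<nu>.sets_multiscale_intensity)
qed

end

section \<open>Moments of the diameter\<close>

lemma finite_net_sphere:
  fixes r :: real
  obtains K :: "(real ^ 'd) set" where "finite K" "\<And>k. k \<in> K \<Longrightarrow> norm k = r" "sphere 0 r \<subseteq> (\<Union>k\<in>K. ball k 1)"
proof -
  have "sphere (0 :: real ^ 'd) r \<subseteq> (\<Union>k\<in>sphere 0 r. ball k 1)" by force
  then obtain K where "K \<subseteq> sphere (0 :: real ^ 'd) r" "finite K" "sphere 0 r \<subseteq> (\<Union>k\<in>K. ball k 1)"
    using compactE_image[OF compact_sphere[of "0 :: real ^ 'd" r], of "sphere 0 r" "\<lambda>k. ball k 1"] by auto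
  then show ?thesis by (intro that[of K]) auto
qed

lemma borel_cylinder: "ball x a \<times> (UNIV :: real set) \<in> sets borel" for x :: "real ^ 'd"
  by (intro borel_open open_Times) auto

text \<open>Shows the crossing as an event of the configuration in a cylinder, the form to which
  \<open>prob_disjoint_regions\<close> applies.\<close>

lemma local_crossing_restriction:
  "local_crossing S x a \<longleftrightarrow>
    S \<inter> ball x (10 * a) \<times> UNIV \<in> {S. joined_in (boolean_set S) (sphere x a) (sphere x (8 * a))}"
  by (simp add: local_crossing_def)

lemma local_crossing_void_algebra:
  "{S. local_crossing S x a} \<in> sets (void_algebra :: ((real ^ 'd) \<times> real) set measure)"
proof -
  have "{S. local_crossing S x a} = (\<lambda>S. S \<inter> ball x (10 * a) \<times> UNIV) -`
      {S. joined_in (boolean_set S) (sphere x a) (sphere x (8 * a))} \<inter> space void_algebra"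
    by (auto simp: local_crossing_def)
  then show ?thesis
    using measurable_sets[OF measurable_Int_void_algebra[OF borel_cylinder] joined_in_void_algebra] by simp
qed

lemma epowr_ennreal: "0 \<le> y \<Longrightarrow> epowr (ennreal y) s = ennreal (y powr s)"
  by (simp add: epowr_def)

lemma epowr_mono: "x \<le> y \<Longrightarrow> 0 \<le> s \<Longrightarrow> epowr x s \<le> epowr y s"
  by (cases x; cases y) (auto simp: epowr_def top_unique intro!: ennreal_leI powr_mono2)

section \<open>Crossing probabilities and moments under stationarity\<close>

locale stationary_void_process = void_process M \<eta> \<Lambda>
  for M :: "'w measure" and \<eta> :: "'w \<Rightarrow> ((real ^ 'd) \<times> real) set" and \<Lambda> +
  assumes stationary: "distr \<Lambda> borel (\<lambda>(c, r). (c - x, r)) = \<Lambda>"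
begin

definition crossing_prob :: "real \<Rightarrow> real" where
  "crossing_prob a = prob {\<omega> \<in> space M. local_crossing (\<eta> \<omega>) 0 a}"

lemma local_crossing_event: "{\<omega> \<in> space M. local_crossing (\<eta> \<omega>) x a} \<in> events"
  using process_event[OF local_crossing_void_algebra[of x a]] by simp

lemma hit_event: "A \<in> sets borel \<Longrightarrow> {\<omega> \<in> space M. \<eta> \<omega> \<inter> A \<noteq> {}} \<in> events"
  using process_event[OF hit_in_void_algebra[of A]] by simp

lemma prob_local_crossing: "prob {\<omega> \<in> space M. local_crossing (\<eta> \<omega>) x a} = crossing_prob a"
proof -
  have "(\<lambda>(c :: real ^ 'd, r :: real). (c - x, r)) \<in> borel_measurable borel"
    unfolding case_prod_beta by (intro borel_measurable_continuous_onI continuous_intros)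
  from prob_image_eq[OF this stationary local_crossing_void_algebra[of 0 a]] show ?thesis
    unfolding crossing_prob_def local_crossing_translation[of _ x] by simp
qed

text \<open>Each event looks at centres within \<open>10 * a\<close> of its own point, so at
  distance \<open>20 * a\<close> the two open cylinders are disjoint.\<close>

lemma prob_distant_crossings:
  assumes "20 * a \<le> dist x y"
  shows "prob {\<omega> \<in> space M. local_crossing (\<eta> \<omega>) x a \<and> local_crossing (\<eta> \<omega>) y a} = (crossing_prob a)\<^sup>2"
proof -
  have "ball x (10 * a) \<inter> ball y (10 * a) = {}"
  proof (intro equals0I)
    fix z assume "z \<in> ball x (10 * a) \<inter> ball y (10 * a)"
    then show False using assms dist_triangle2[of x y z] by simp
  qed
  then have "ball x (10 * a) \<times> UNIV \<inter> ball y (10 * a) \<times> (UNIV :: real set) = {}" by auto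
  from prob_disjoint_regions[OF borel_cylinder borel_cylinder this joined_in_void_algebra joined_in_void_algebra]
  have "prob {\<omega> \<in> space M. local_crossing (\<eta> \<omega>) x a \<and> local_crossing (\<eta> \<omega>) y a}
    = prob {\<omega> \<in> space M. local_crossing (\<eta> \<omega>) x a} * prob {\<omega> \<in> space M. local_crossing (\<eta> \<omega>) y a}"
    by (simp only: local_crossing_restriction)
  then show ?thesis by (simp add: prob_local_crossing power2_eq_square)
qed

lemma prob_hit_large_balls_le:
  assumes "emeasure \<Lambda> (large_balls a) < \<infinity>"
  shows "prob {\<omega> \<in> space M. \<eta> \<omega> \<inter> large_balls a \<noteq> {}} \<le> measure \<Lambda> (large_balls a)"
  using emeasure_hit_le[OF borel_large_balls[of a]] assms
  by (simp add: emeasure_eq_measure emeasure_eq_ennreal_measure less_top ennreal_le_iff)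

text \<open>A union bound over the pairs of net points from the cascade, plus the event of a large
  ball. The nets are fixed at unit scale and multiplied by \<open>a\<close>, which makes
  \<open>C\<close> the same for all scales.\<close>

lemma crossing_prob_recursion:
  obtains C where
    "\<And>a. 0 < a \<Longrightarrow> emeasure \<Lambda> (large_balls a) < \<infinity> \<Longrightarrow>
      crossing_prob (10 * a) \<le> C * (crossing_prob a)\<^sup>2 + measure \<Lambda> (large_balls a)"
proof -
  obtain K :: "(real ^ 'd) set" where K: "finite K" "\<And>k. k \<in> K \<Longrightarrow> norm k = 10"
    "sphere 0 10 \<subseteq> (\<Union>k\<in>K. ball k 1)" by (rule finite_net_sphere[of 10]) blast
  obtain L :: "(real ^ 'd) set" where L: "finite L" "\<And>k. k \<in> L \<Longrightarrow> norm k = 80"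
    "sphere 0 80 \<subseteq> (\<Union>k\<in>L. ball k 1)" by (rule finite_net_sphere[of 80]) blast
  have "crossing_prob (10 * a) \<le> real (card (K \<times> L)) * (crossing_prob a)\<^sup>2 + measure \<Lambda> (large_balls a)"
    if a: "0 < a" and fin: "emeasure \<Lambda> (large_balls a) < \<infinity>" for a
  proof -
    define E where "E = (\<lambda>(k, l). {\<omega> \<in> space M. local_crossing (\<eta> \<omega>) (a *\<^sub>R k) a \<and> local_crossing (\<eta> \<omega>) (a *\<^sub>R l) a})"
    let ?H = "{\<omega> \<in> space M. \<eta> \<omega> \<inter> large_balls a \<noteq> {}}"
    have E: "E z \<in> events" for z
      unfolding E_def case_prod_beta by (intro sets.sets_Collect_conj local_crossing_event)
    have H: "?H \<in> events" by (rule hit_event[OF borel_large_balls])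
    have U: "(\<Union>z\<in>K \<times> L. E z) \<in> events" using E K L by (intro sets.finite_UN) auto
    have "{\<omega> \<in> space M. local_crossing (\<eta> \<omega>) 0 (10 * a)} \<subseteq> (\<Union>z\<in>K \<times> L. E z) \<union> ?H"
    proof
      fix \<omega> assume \<omega>: "\<omega> \<in> {\<omega> \<in> space M. local_crossing (\<eta> \<omega>) 0 (10 * a)}"
      show "\<omega> \<in> (\<Union>z\<in>K \<times> L. E z) \<union> ?H"
      proof (cases "\<eta> \<omega> \<inter> large_balls a = {}")
        case True
        then have "\<exists>k\<in>K. \<exists>l\<in>L. local_crossing (\<eta> \<omega>) (a *\<^sub>R k) a \<and> local_crossing (\<eta> \<omega>) (a *\<^sub>R l) a"
          using \<omega> a K L by (intro local_crossing_cascade) auto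
        then show ?thesis using \<omega> by (force simp: E_def)
      qed (use \<omega> in auto)
    qed
    then have "crossing_prob (10 * a) \<le> prob ((\<Union>z\<in>K \<times> L. E z) \<union> ?H)"
      unfolding crossing_prob_def using U H by (intro finite_measure_mono) auto
    also have "\<dots> \<le> prob (\<Union>z\<in>K \<times> L. E z) + prob ?H" by (rule measure_Un_le[OF U H])
    also have "prob (\<Union>z\<in>K \<times> L. E z) \<le> (\<Sum>z\<in>K \<times> L. prob (E z))"
      using E K L by (intro finite_measure_subadditive_finite) auto
    also have "(\<Sum>z\<in>K \<times> L. prob (E z)) = (\<Sum>z\<in>K \<times> L. (crossing_prob a)\<^sup>2)"
    proof (intro sum.cong refl)
      fix z assume z: "z \<in> K \<times> L"
      obtain k l where kl: "z = (k, l)" by (cases z)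
      \<comment> \<open>The difference of the norms is \<open>80 * a - 10 * a\<close>.\<close>
      have "20 * a \<le> norm (a *\<^sub>R l) - norm (a *\<^sub>R k)" using z kl K(2) L(2) a by auto
      also have "\<dots> \<le> dist (a *\<^sub>R k) (a *\<^sub>R l)"
        using norm_triangle_ineq2[of "a *\<^sub>R l" "a *\<^sub>R k"] by (simp only: dist_norm norm_minus_commute)
      finally show "prob (E z) = (crossing_prob a)\<^sup>2" unfolding E_def kl prod.case by (rule prob_distant_crossings)
    qed
    finally show ?thesis using prob_hit_large_balls_le[OF fin] by simp
  qed
  then show ?thesis by (intro that)
qed

text \<open>Off the bad event \<open>F k\<close> the diameter is at most \<open>16 * 10 ^ k\<close>,
  so the moment is controlled by the sum of \<open>b ^ k\<close> times the probability of
  \<open>F k\<close>. That probability is at most \<open>p k + g k\<close>, and both weighted series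
  converge.\<close>

lemma origin_diameter_moment_finite:
  assumes s: "0 < s" and lim: "(\<lambda>k. crossing_prob (10 ^ k)) \<longlonglongrightarrow> 0"
    and moment: "(\<Sum>k. ennreal ((10 powr s) ^ k) * emeasure \<Lambda> (large_balls (10 ^ k))) < \<infinity>"
  shows "(\<integral>\<^sup>+ \<omega>. epowr (origin_diameter (boolean_set (\<eta> \<omega>))) s \<partial>M) < \<infinity>"
proof -
  define b where "b = 10 powr s"
  have b: "1 \<le> b" using s by (simp add: b_def ge_one_powr_ge_zero)
  define p where "p k = crossing_prob (10 ^ k)" for k
  define g where "g k = measure \<Lambda> (large_balls (10 ^ k))" for k
  have fin: "emeasure \<Lambda> (large_balls (10 ^ k)) < \<infinity>" for k
  proof (rule ccontr)
    assume "\<not> emeasure \<Lambda> (large_balls (10 ^ k)) < \<infinity>"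
    then have "ennreal (b ^ k) * emeasure \<Lambda> (large_balls (10 ^ k)) = \<infinity>"
      using b by (simp add: ennreal_mult_top less_top[symmetric])
    moreover have "f k \<le> (\<Sum>k. f k)" for f :: "nat \<Rightarrow> ennreal"
      using sum_le_suminf[of f "{k}"] by simp
    from this[of "\<lambda>k. ennreal (b ^ k) * emeasure \<Lambda> (large_balls (10 ^ k))"]
    have "ennreal (b ^ k) * emeasure \<Lambda> (large_balls (10 ^ k)) < \<infinity>"
      using moment unfolding b_def by (rule le_less_trans)
    ultimately show False by simp
  qed
  have eg: "emeasure \<Lambda> (large_balls (10 ^ k)) = ennreal (g k)" for k
    using fin[of k] by (simp add: g_def emeasure_eq_ennreal_measure less_top)
  have p0: "0 \<le> p k" and g0: "0 \<le> g k" for k by (auto simp: p_def g_def crossing_prob_def)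
  have sum_g: "summable (\<lambda>k. b ^ k * g k)"
    using moment b g0 unfolding eg b_def[symmetric]
    by (intro summable_suminf_not_top) (auto simp: ennreal_mult[symmetric] less_top[symmetric])
  obtain C where C: "\<And>a. 0 < a \<Longrightarrow> emeasure \<Lambda> (large_balls a) < \<infinity> \<Longrightarrow>
      crossing_prob (10 * a) \<le> C * (crossing_prob a)\<^sup>2 + measure \<Lambda> (large_balls a)"
    by (rule crossing_prob_recursion) blast
  have sum_p: "summable (\<lambda>k. b ^ k * p k)"
  proof (rule summable_of_quadratic_recursion[OF p0 _ _ _ g0 sum_g])
    show "p (Suc k) \<le> C * (p k)\<^sup>2 + g k" for k
      using C[of "10 ^ k"] fin[of k] by (simp add: p_def g_def)
  qed (use lim b in \<open>auto simp: p_def\<close>)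
  define F where "F k = {\<omega> \<in> space M. local_crossing (\<eta> \<omega>) 0 (10 ^ k)} \<union> {\<omega> \<in> space M. \<eta> \<omega> \<inter> large_balls (10 ^ k) \<noteq> {}}" for k
  have F [measurable]: "F k \<in> events" for k
    unfolding F_def by (intro sets.Un local_crossing_event hit_event borel_large_balls)
  have PF: "emeasure M (F k) \<le> ennreal (p k + g k)" for k
  proof -
    have "prob (F k) \<le> p k + prob {\<omega> \<in> space M. \<eta> \<omega> \<inter> large_balls (10 ^ k) \<noteq> {}}"
      unfolding F_def p_def crossing_prob_def
      by (intro measure_Un_le local_crossing_event hit_event borel_large_balls)
    then show ?thesis using prob_hit_large_balls_le[OF fin[of k]] by (simp add: emeasure_eq_measure g_def ennreal_leI)
  qed
  define D where "D \<omega> = origin_diameter (boolean_set (\<eta> \<omega>))" for \<omega>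
  have D_le: "D \<omega> \<le> ennreal (16 * 10 ^ k)" if "\<omega> \<in> space M" "\<omega> \<notin> F k" for \<omega> k
    unfolding D_def using that by (intro origin_diameter_le) (auto simp: F_def)
  have pw: "epowr (D \<omega>) s \<le> ennreal (16 powr s) + (\<Sum>k. ennreal (160 powr s * b ^ k) * indicator (F k) \<omega>)"
    if \<omega>: "\<omega> \<in> space M" for \<omega>
  proof (cases "\<forall>k. \<omega> \<in> F k")
    case True
    \<comment> \<open>If every scale is bad the bound is infinite, since all its weights are at
      least 1.\<close>
    have "(\<Sum>k::nat. 1 :: ennreal) \<le> (\<Sum>k. ennreal (160 powr s * b ^ k) * indicator (F k) \<omega>)"
    proof (intro suminf_le summableI)
      fix k
      have "1 * 1 \<le> 160 powr s * b ^ k" using s b by (intro mult_mono) (auto simp: ge_one_powr_ge_zero one_le_power)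
      then have "ennreal 1 \<le> ennreal (160 powr s * b ^ k)" by (intro ennreal_leI) simp
      then show "1 \<le> ennreal (160 powr s * b ^ k) * indicator (F k) \<omega>" using True by simp
    qed
    then show ?thesis by (simp add: suminf_const_ennreal_eq_top top_unique)
  next
    case False
    define m where "m = (LEAST k. \<omega> \<notin> F k)"
    have m: "\<omega> \<notin> F m" unfolding m_def using False LeastI_ex[of "\<lambda>k. \<omega> \<notin> F k"] by blast
    have Dm: "epowr (D \<omega>) s \<le> ennreal ((16 * 10 ^ m) powr s)"
      using epowr_mono[OF D_le[OF \<omega> m], of s] s by (simp add: epowr_ennreal)
    show ?thesis
    proof (cases m)
      case 0
      then show ?thesis using Dm by (simp add: add_increasing2)
    next
      case (Suc j)
      have j: "\<omega> \<in> F j" using not_less_Least[of j "\<lambda>k. \<omega> \<notin> F k"] Suc unfolding m_def by auto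
      \<comment> \<open>The bad scale \<open>j\<close> just below the first good scale
        \<open>m\<close> pays for the diameter; \<open>160 = 16 * 10\<close> accounts for the one
        step between them.\<close>
      have "(16 * 10 ^ m) powr s = 160 powr s * b ^ j"
        unfolding Suc b_def by (subst power_powr[symmetric], simp, subst powr_mult[symmetric]) auto
      then have "epowr (D \<omega>) s \<le> ennreal (160 powr s * b ^ j) * indicator (F j) \<omega>" using Dm j by simp
      also have "f j \<le> (\<Sum>k. f k)" for f :: "nat \<Rightarrow> ennreal"
        using sum_le_suminf[of f "{j}"] by simp
      from this[of "\<lambda>j. ennreal (160 powr s * b ^ j) * indicator (F j) \<omega>"]
      have "ennreal (160 powr s * b ^ j) * indicator (F j) \<omega> \<le> (\<Sum>k. ennreal (160 powr s * b ^ k) * indicator (F k) \<omega>)" .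
      finally show ?thesis by (simp add: add_increasing)
    qed
  qed
  have "(\<integral>\<^sup>+ \<omega>. epowr (D \<omega>) s \<partial>M)
    \<le> (\<integral>\<^sup>+ \<omega>. ennreal (16 powr s) + (\<Sum>k. ennreal (160 powr s * b ^ k) * indicator (F k) \<omega>) \<partial>M)"
    by (intro nn_integral_mono pw)
  also have "\<dots> = ennreal (16 powr s) + (\<Sum>k. ennreal (160 powr s * b ^ k) * emeasure M (F k))"
    by (subst nn_integral_add) (auto simp: nn_integral_suminf nn_integral_cmult_indicator emeasure_space_1)
  also have "\<dots> \<le> ennreal (16 powr s) + (\<Sum>k. ennreal (160 powr s * b ^ k) * ennreal (p k + g k))"
    by (intro add_left_mono suminf_le summableI mult_left_mono PF) auto
  also have "(\<Sum>k. ennreal (160 powr s * b ^ k) * ennreal (p k + g k)) = (\<Sum>k. ennreal (160 powr s * (b ^ k * p k + b ^ k * g k)))"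
    using b p0 g0 by (intro suminf_cong) (simp add: ennreal_mult[symmetric] algebra_simps)
  also have "ennreal (16 powr s) + \<dots> < \<infinity>"
  proof -
    have "(\<Sum>k. ennreal (160 powr s * (b ^ k * p k + b ^ k * g k))) \<noteq> \<top>"
      by (rule ennreal_suminf_neq_top[OF summable_mult[OF summable_add[OF sum_p sum_g]]])
        (use b p0 g0 in simp)
    then show ?thesis by (simp add: less_top[symmetric])
  qed
  finally show ?thesis unfolding D_def .
qed

text \<open>On \<open>F k\<close> the diameter is at least \<open>10 ^ k\<close>, so the decadic sum
  at the value of the diameter dominates the weighted sum of the indicators of the
  \<open>F k\<close>. Taking expectations leaves the divergent series.\<close>

lemma origin_diameter_moment_infinite:
  assumes s: "0 < s"
    and div: "(\<Sum>k. ennreal ((10 powr s) ^ k) * ennreal (1 - neg_exp (emeasure \<Lambda> (covering_balls (10 ^ k))))) = \<infinity>"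
  shows "(\<integral>\<^sup>+ \<omega>. epowr (origin_diameter (boolean_set (\<eta> \<omega>))) s \<partial>M) = \<infinity>"
proof -
  define b where "b = 10 powr s"
  obtain C where C: "0 < C"
    "\<And>y. (\<Sum>k. ennreal (b ^ k) * indicator {10 ^ k..} y) \<le> ennreal (C * y powr s) * indicator {1..} y"
    unfolding b_def by (rule sum_decadic_powr_le[OF s]) blast
  define D where "D \<omega> = origin_diameter (boolean_set (\<eta> \<omega>))" for \<omega>
  define F where "F k = {\<omega> \<in> space M. \<eta> \<omega> \<inter> covering_balls (10 ^ k) \<noteq> {}}" for k
  have F [measurable]: "F k \<in> events" for k
    unfolding F_def by (rule hit_event[OF borel_covering_balls])
  have D_ge: "ennreal (10 ^ k) \<le> D \<omega>" if \<omega>: "\<omega> \<in> F k" for \<omega> k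
  proof -
    obtain c r where cr: "(c, r) \<in> \<eta> \<omega>" "10 ^ k \<le> r" "norm c < r"
      using \<omega> by (auto simp: F_def covering_balls_def)
    have "ennreal (10 ^ k) \<le> ennreal r" using cr by (intro ennreal_leI)
    also have "\<dots> \<le> D \<omega>" unfolding D_def by (rule origin_diameter_ge[OF cr(1,3)])
    finally show ?thesis .
  qed
  have pw: "ennreal (1 / C) * (\<Sum>k. ennreal (b ^ k) * indicator (F k) \<omega>) \<le> epowr (D \<omega>) s" for \<omega>
  proof (cases "D \<omega>")
    case (real y)
    have "(\<Sum>k. ennreal (b ^ k) * indicator (F k) \<omega>) \<le> (\<Sum>k. ennreal (b ^ k) * indicator {10 ^ k..} y)"
      using D_ge[of \<omega>] real by (intro suminf_le summableI mult_left_mono) (auto simp: indicator_def ennreal_le_iff)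
    also have "\<dots> \<le> ennreal (C * y powr s) * indicator {1..} y" by (rule C(2))
    also have "\<dots> \<le> ennreal (C * y powr s)" by (auto simp: indicator_def)
    finally have "ennreal (1 / C) * (\<Sum>k. ennreal (b ^ k) * indicator (F k) \<omega>) \<le> ennreal (1 / C) * ennreal (C * y powr s)"
      by (rule mult_left_mono) simp
    also have "\<dots> = ennreal (y powr s)" using C(1) by (simp add: ennreal_mult[symmetric])
    finally show ?thesis using real by (simp add: epowr_ennreal)
  qed (simp add: epowr_def)
  have "\<infinity> = ennreal (1 / C) * (\<Sum>k. ennreal (b ^ k) * emeasure M (F k))"
    using div C(1) unfolding F_def b_def emeasure_eq_measure prob_hit[OF borel_covering_balls]
    by (simp add: ennreal_mult_top)
  also have "\<dots> = (\<integral>\<^sup>+ \<omega>. ennreal (1 / C) * (\<Sum>k. ennreal (b ^ k) * indicator (F k) \<omega>) \<partial>M)"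
    by (subst nn_integral_cmult) (auto simp: nn_integral_suminf nn_integral_cmult_indicator)
  also have "\<dots> \<le> (\<integral>\<^sup>+ \<omega>. epowr (D \<omega>) s \<partial>M)"
    by (intro nn_integral_mono pw)
  finally show ?thesis by (simp add: D_def top_unique)
qed

text \<open>The assumed limit is used along \<open>r = 2 * 10 ^ k\<close>.\<close>

lemma crossing_prob_tendsto_0:
  assumes "((\<lambda>r. prob {\<omega> \<in> space M. joined_in (boolean_set (\<eta> \<omega>)) (sphere 0 (r / 2)) (sphere 0 r)}) \<longlongrightarrow> 0) at_top"
  shows "(\<lambda>k. crossing_prob (10 ^ k)) \<longlonglongrightarrow> 0"
proof -
  let ?q = "\<lambda>r. prob {\<omega> \<in> space M. joined_in (boolean_set (\<eta> \<omega>)) (sphere 0 (r / 2)) (sphere 0 r)}"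
  have "filterlim (\<lambda>k::nat. 2 * 10 ^ k :: real) at_top sequentially"
    by (intro filterlim_tendsto_pos_mult_at_top[OF tendsto_const]
        filterlim_at_infinity_imp_filterlim_at_top filterlim_realpow_sequentially_gt1) auto
  from filterlim_compose[OF assms this]
  have "(\<lambda>k. ?q (2 * 10 ^ k)) \<longlonglongrightarrow> 0" .
  then show ?thesis
  proof (rule tendsto_sandwich[OF always_eventually always_eventually tendsto_const, rotated 2]; intro allI)
    fix k :: nat
    show "0 \<le> crossing_prob (10 ^ k)" by (simp add: crossing_prob_def)
    have "{\<omega> \<in> space M. joined_in (boolean_set (\<eta> \<omega>)) (sphere 0 (10 ^ k)) (sphere 0 (2 * 10 ^ k))} \<in> events"
      using process_event[OF joined_in_void_algebra] by simp
    then show "crossing_prob (10 ^ k) \<le> ?q (2 * 10 ^ k)"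
      unfolding crossing_prob_def
      using local_crossing_joined[of _ "10 ^ k"] by (intro finite_measure_mono) auto
  qed
qed

end

section \<open>Moments of the diameter in the multiscale Boolean model\<close>

theorem theorem5:
  fixes M :: "'w measure"
    and \<mu> :: "real measure"
    and \<xi> :: "nat \<Rightarrow> 'w \<Rightarrow> ((real ^ 'd) \<times> real) set"
    and s lam \<rho> :: real
  assumes "CARD('d) \<ge> 2"
    and "sets \<mu> = sets (restrict_space borel {0<..})"
    and "finite_measure \<mu>"
    and "emeasure \<mu> (space \<mu>) > 0"
    and "s > 0" and "lam > 0" and "\<rho> > 1"
    and "prob_space M"
    and "prob_space.independent_boolean_drivers M (scale_measure (ennreal lam) \<mu>) \<xi>"
  defines "\<Sigma> \<equiv> (\<lambda>\<omega>. multiscale_set \<rho> (\<lambda>n. \<xi> n \<omega>))"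
  shows "((\<integral>\<^sup>+ \<beta>\<in>{1..}. ennreal (\<beta> powr (real CARD('d) + s)) \<partial>\<mu>) < \<infinity> \<and>
          ((\<lambda>r. measure M {\<omega> \<in> space M. joined_in (\<Sigma> \<omega>) (sphere 0 (r / 2)) (sphere 0 r)})
             \<longlongrightarrow> 0) at_top
          \<longrightarrow> (\<integral>\<^sup>+ \<omega>. epowr (origin_diameter (\<Sigma> \<omega>)) s \<partial>M) < \<infinity>) \<and>
         ((\<integral>\<^sup>+ \<beta>\<in>{1..}. ennreal (\<beta> powr (real CARD('d) + s)) \<partial>\<mu>) = \<infinity>
          \<longrightarrow> (\<integral>\<^sup>+ \<omega>. epowr (origin_diameter (\<Sigma> \<omega>)) s \<partial>M) = \<infinity>)"
proof -
  define \<nu> where "\<nu> = scale_measure (ennreal lam) \<mu>"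
  interpret \<mu>: radius_measure \<mu>
    using assms by (simp add: radius_measure_def radius_measure_axioms_def)
  have "radius_measure \<nu>"
  proof -
    have "finite_measure \<nu>"
      by (rule finite_measureI) (simp add: \<nu>_def space_scale_measure ennreal_mult_eq_top_iff \<mu>.emeasure_eq_measure)
    then show ?thesis using assms by (simp add: radius_measure_def radius_measure_axioms_def \<nu>_def)
  qed
  then interpret \<nu>: radius_measure \<nu> .
  interpret prob_space M by fact
  let ?\<eta> = "\<lambda>\<omega>. superposition \<rho> (\<lambda>n. \<xi> n \<omega>)"
  have "void_process M ?\<eta> (multiscale_intensity \<rho> \<nu>)"
    using assms \<open>radius_measure \<nu>\<close> by (intro void_process_superposition) (auto simp: \<nu>_def)
  then interpret stationary_void_process M ?\<eta> "multiscale_intensity \<rho> \<nu>"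
    by (rule stationary_void_process.intro)
      (use assms in \<open>intro stationary_void_process_axioms.intro \<nu>.multiscale_intensity_translation, simp\<close>)
  have \<Sigma>: "\<Sigma> \<omega> = boolean_set (?\<eta> \<omega>)" for \<omega>
    using assms by (simp add: \<Sigma>_def multiscale_set_superposition)
  \<comment> \<open>As \<open>lam\<close> is positive and finite, the moment is finite for \<mu>
    exactly when it is finite for \<nu>.\<close>
  have moment: "(\<integral>\<^sup>+ \<beta>\<in>{1..}. ennreal (\<beta> powr (real CARD('d) + s)) \<partial>\<nu>) =
    ennreal lam * (\<integral>\<^sup>+ \<beta>\<in>{1..}. ennreal (\<beta> powr (real CARD('d) + s)) \<partial>\<mu>)"
    unfolding \<nu>_def by (intro nn_integral_scale_measure \<mu>.measurable_radius) measurable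
  show ?thesis
  proof (intro conjI impI; (elim conjE)?)
    assume fin: "(\<integral>\<^sup>+ \<beta>\<in>{1..}. ennreal (\<beta> powr (real CARD('d) + s)) \<partial>\<mu>) < \<infinity>"
      and lim: "((\<lambda>r. prob {\<omega> \<in> space M. joined_in (\<Sigma> \<omega>) (sphere 0 (r / 2)) (sphere 0 r)}) \<longlongrightarrow> 0) at_top"
    have "(\<integral>\<^sup>+ \<beta>\<in>{1..}. ennreal (\<beta> powr (real CARD('d) + s)) \<partial>\<nu>) < \<infinity>"
      using fin by (simp add: moment ennreal_mult_less_top)
    then show "(\<integral>\<^sup>+ \<omega>. epowr (origin_diameter (\<Sigma> \<omega>)) s \<partial>M) < \<infinity>"
      unfolding \<Sigma> using assms lim[unfolded \<Sigma>]
      by (intro origin_diameter_moment_finite crossing_prob_tendsto_0 \<nu>.large_balls_moment)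
  next
    assume "(\<integral>\<^sup>+ \<beta>\<in>{1..}. ennreal (\<beta> powr (real CARD('d) + s)) \<partial>\<mu>) = \<infinity>"
    then have "(\<integral>\<^sup>+ \<beta>\<in>{1..}. ennreal (\<beta> powr (real CARD('d) + s)) \<partial>\<nu>) = \<infinity>"
      using assms by (simp add: moment ennreal_mult_top)
    then show "(\<integral>\<^sup>+ \<omega>. epowr (origin_diameter (\<Sigma> \<omega>)) s \<partial>M) = \<infinity>"
      unfolding \<Sigma> using assms by (intro origin_diameter_moment_infinite \<nu>.covering_balls_divergence) auto
  qed
qed

end
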